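(* The construction of a suspension flow is functorial. That is, there exists a functor $\Sigma: \mathbf{Map} \to \mathbf{FlowGS}$ defined by setting: (i) $\Sigma(f, X) = (\Sigma f, X_f, (X_f)_0)$ for each object $(f, X)$ of $\mathbf{Map}$, where $(X_f)_0 = \{[x,0] \mid x \in X\}$; (ii) for each morphism $h:(f, X) \to (g, Y)$ of $\mathbf{Map}$, $\Sigma(h) = \bar h: (\Sigma f, X_f, (X_f)_0) \to (\Sigma g, Y_g, (Y_g)_0)$, where $\bar h([x,t]) = [h(x), t]$ (and $(Y_g)_0=\{[y,0]\mid y\in Y\}$).
   Context: Topological manifolds are assumed second countable and Hausdorff. $\mathbf{Map}$ is the category whose objects are pairs $(f,X)$ with $X$ a topological manifold without boundary and $f:X\to X$ a homeomorphism, and whose morphisms $h:(f,X)\to(g,Y)$ are continuous maps $h:X\to Y$ with $h\circ f=g\circ h$. A flow $(\Phi,X)$ is a topological manifold $X$ without boundary together with a continuous map $\Phi: X\times\mathbb{R}\to X$ with $\Phi(x,0)=x$ and $\Phi(\Phi(x,t),s)=\Phi(x,t+s)$. A morphism of flows $h:(\Phi,X)\to(\Psi,Y)$ is a continuous map $h:X\to Y$ with $h(\Phi(x,t))=\Psi(h(x),t)$ for all $x\in X$, $t\in\mathbb{R}$. Sections. Let $X$ be $n$-dimensional. A submanifold $S\subset X$ without boundary is topologically transversal to $\Phi$ if: (1) $S$ is of codimension one and locally flat. (2) For each $x\in S$ there exist a neighborhood $U$ of $x$ in $X$ and a homeomorphism $\phi:U\to B\subset\mathbb{R}^n$, where $B$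 is the unit ball, such that $\phi(U\cap S)=B\cap(\mathbb{R}^{n-1}\times\{0\})$. Further, there exist $\delta_+(x)>0$ and $\delta_-(x)<0$ such that $\Phi(x,[\delta_-(x),0))$ and $\Phi(x,(0,\delta_+(x)])$ are contained in different connected components of $U\setminus S$ and $\Phi(x,[\delta_-(x),\delta_+(x)])\cap S=\{x\}$. Here $\delta_+$ and $\delta_-$ can be taken locally uniformly, that is, there exist a neighborhood $V\subset U$ of $x$ and $\delta>0$ such that $\delta_+(y)>\delta$ and $\delta_-(y)<-\delta$ for all $y\in V\cap S$. (3) For each set of the form $\Phi(y,[a,b])$, where $y\in X$ and $a,b\in\mathbb{R}$, $\Phi(y,[a,b])\cap S$ is compact in $S$. A submanifold $S\subset X$ is a global Poincaré section if $S$ is topologically transversal to $\Phi$ and for each $x\in X$ there exist $t_+>0$ and $t_-<0$ with $\Phi(x,t_+)\in S$ and $\Phi(x,t_-)\in S$. $\mathbf{FlowGS}$ is the category whose objects are triples $(\Phi,X,S)$ with $(\Phi,X)$ a flow and $S$ a global Poincaré section, and whose morphisms $(\Phi,X,S)\to(\Psi,Y,S')$ are the morphisms of flows $h$ with $S=h^{-1}(S')$. Suspension. For a homeomorphism $f:X\to X$ of a topological manifold, the mapping torus is $X_f:=X\times[0,1]/\sim$, where $\sim$ is the smallest equivalence relation with $(x,1)\sim(f(x),0)$ for each $x\in X$. Points of $X_f$ are denoted $[x,t]$ with $x\in X$, $0\le t<1$. The suspension flow $\Sigma f:X_f\times\mathbb{R}\to X_f$ is $\Sigma f([x,t],s):=[f^n(x),s+t-n]$,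 where $n\in\mathbb{Z}$ is the unique integer with $s+t-1<n\le s+t$. *)

theory Defs
  imports "HOL-Analysis.Analysis"
begin

section \<open>Categories and functors\<close>

text \<open>
  Morphisms do not carry their domain and codomain, so composition and the morphism part of a
  functor take the objects involved as arguments: \<open>Comp C A B D k h\<close> is
  \<open>k \<circ> h\<close> for \<open>h : A \<rightarrow> B\<close> and \<open>k : B \<rightarrow> D\<close>.
\<close>

record ('o, 'm) precategory =
  Obj :: "'o set"
  Hom :: "'o \<Rightarrow> 'o \<Rightarrow> 'm set"
  Ident :: "'o \<Rightarrow> 'm"
  Comp :: "'o \<Rightarrow> 'o \<Rightarrow> 'o \<Rightarrow> 'm \<Rightarrow> 'm \<Rightarrow> 'm"

locale category =
  fixes C :: "('o, 'm) precategory"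
  assumes ident_in_hom: "A \<in> Obj C \<Longrightarrow> Ident C A \<in> Hom C A A"
    and comp_in_hom: "\<lbrakk>A \<in> Obj C; B \<in> Obj C; D \<in> Obj C; h \<in> Hom C A B; k \<in> Hom C B D\<rbrakk>
      \<Longrightarrow> Comp C A B D k h \<in> Hom C A D"
    and ident_left: "\<lbrakk>A \<in> Obj C; B \<in> Obj C; h \<in> Hom C A B\<rbrakk>
      \<Longrightarrow> Comp C A B B (Ident C B) h = h"
    and ident_right: "\<lbrakk>A \<in> Obj C; B \<in> Obj C; h \<in> Hom C A B\<rbrakk>
      \<Longrightarrow> Comp C A A B h (Ident C A) = h"
    and comp_assoc: "\<lbrakk>A \<in> Obj C; B \<in> Obj C; D \<in> Obj C; E \<in> Obj C;
        h \<in> Hom C A B; k \<in> Hom C B D; l \<in> Hom C D E\<rbrakk>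
      \<Longrightarrow> Comp C A D E l (Comp C A B D k h) = Comp C A B E (Comp C B D E l k) h"

record ('o1, 'm1, 'o2, 'm2) prefunctor =
  obj_map :: "'o1 \<Rightarrow> 'o2"
  mor_map :: "'o1 \<Rightarrow> 'o1 \<Rightarrow> 'm1 \<Rightarrow> 'm2"

locale cat_functor = source: category C + target: category D
  for C :: "('o1, 'm1) precategory" and D :: "('o2, 'm2) precategory" +
  fixes F :: "('o1, 'm1, 'o2, 'm2) prefunctor"
  assumes obj_map_in: "A \<in> Obj C \<Longrightarrow> obj_map F A \<in> Obj D"
    and mor_map_in: "\<lbrakk>A \<in> Obj C; B \<in> Obj C; h \<in> Hom C A B\<rbrakk>
      \<Longrightarrow> mor_map F A B h \<in> Hom D (obj_map F A) (obj_map F B)"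
    and mor_map_ident: "A \<in> Obj C \<Longrightarrow> mor_map F A A (Ident C A) = Ident D (obj_map F A)"
    and mor_map_comp: "\<lbrakk>A \<in> Obj C; B \<in> Obj C; E \<in> Obj C; h \<in> Hom C A B; k \<in> Hom C B E\<rbrakk>
      \<Longrightarrow> mor_map F A E (Comp C A B E k h)
        = Comp D (obj_map F A) (obj_map F B) (obj_map F E) (mor_map F B E k) (mor_map F A B h)"


section \<open>Topological manifolds\<close>

text \<open>
  \<open>Euclidean_space n\<close> consists of the sequences vanishing from index \<open>n\<close> on, so
  \<open>topspace (Euclidean_space k)\<close> with \<open>k \<le> n\<close> is the standard copy
  of \<open>\<real>\<^sup>k \<times> {0}\<close> in \<open>\<real>\<^sup>n\<close>.
\<close>

definition manifold_of_dim :: "nat \<Rightarrow> 'a topology \<Rightarrow> bool" where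
  "manifold_of_dim n X \<longleftrightarrow> Hausdorff_space X \<and> second_countable X \<and>
    (\<forall>x\<in>topspace X. \<exists>U W. openin X U \<and> x \<in> U \<and> openin (Euclidean_space n) W \<and>
      subtopology X U homeomorphic_space subtopology (Euclidean_space n) W)"

definition manifold :: "'a topology \<Rightarrow> bool" where
  "manifold X \<longleftrightarrow> (\<exists>n. manifold_of_dim n X)"

definition locally_flat :: "nat \<Rightarrow> nat \<Rightarrow> 'a topology \<Rightarrow> 'a set \<Rightarrow> bool" where
  "locally_flat k n X S \<longleftrightarrow> (\<forall>x\<in>S. \<exists>U \<phi>. openin X U \<and> x \<in> U \<and>
    homeomorphic_map (subtopology X U) (Euclidean_space n) \<phi> \<and>
    \<phi> ` (U \<inter> S) = topspace (Euclidean_space k))"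

definition unit_ball :: "nat \<Rightarrow> (nat \<Rightarrow> real) set" where
  "unit_ball n = {v \<in> topspace (Euclidean_space n). (\<Sum>i<n. (v i)\<^sup>2) < 1}"


section \<open>Homeomorphisms, flows and sections\<close>

text \<open>
  A space is a topology on a subset of a type \<open>'a\<close>. Self-maps, flows and morphisms are
  extensional (\<open>undefined\<close> off their domain), so that objects and morphisms are determined by
  their values on the space.
\<close>

type_synonym 'a map_obj = "('a \<Rightarrow> 'a) \<times> 'a topology"

definition Map_cat :: "('a map_obj, 'a \<Rightarrow> 'a) precategory" where
  "Map_cat = \<lparr>
     Obj = {(f, X). manifold X \<and> homeomorphic_map X X f \<and> f \<in> extensional (topspace X)},
     Hom = (\<lambda>(f, X) (g, Y). {h. continuous_map X Y h \<and> h \<in> extensional (topspace X) \<and>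
              (\<forall>x\<in>topspace X. h (f x) = g (h x))}),
     Ident = (\<lambda>(f, X). \<lambda>x\<in>topspace X. x),
     Comp = (\<lambda>(f, X) _ _ k h. compose (topspace X) k h)\<rparr>"

definition flow :: "('a \<times> real \<Rightarrow> 'a) \<Rightarrow> 'a topology \<Rightarrow> bool" where
  "flow \<Phi> X \<longleftrightarrow> manifold X \<and> \<Phi> \<in> extensional (topspace X \<times> UNIV) \<and>
    continuous_map (prod_topology X euclideanreal) X \<Phi> \<and>
    (\<forall>x\<in>topspace X. \<Phi> (x, 0) = x) \<and>
    (\<forall>x\<in>topspace X. \<forall>t s. \<Phi> (\<Phi> (x, t), s) = \<Phi> (x, t + s))"

definition flow_morphism ::
  "('a \<times> real \<Rightarrow> 'a) \<Rightarrow> 'a topology \<Rightarrow> ('b \<times> real \<Rightarrow> 'b) \<Rightarrow> 'b topology \<Rightarrow> ('a \<Rightarrow> 'b) \<Rightarrow> bool" where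
  "flow_morphism \<Phi> X \<Psi> Y h \<longleftrightarrow> continuous_map X Y h \<and> h \<in> extensional (topspace X) \<and>
    (\<forall>x\<in>topspace X. \<forall>t. h (\<Phi> (x, t)) = \<Psi> (h x, t))"

text \<open>
  In the second condition \<open>\<delta>p\<close> and \<open>\<delta>m\<close> are functions on all of \<open>S\<close>, whereas \<open>U\<close>, \<open>\<phi>\<close>,
  \<open>V\<close> and \<open>\<delta>\<close> depend on \<open>x\<close>. Coordinates are indexed from 0, so \<open>\<real>\<^sup>n\<^sup>-\<^sup>1 \<times> {0}\<close> is
  given by the vanishing of coordinate \<open>n - 1\<close>.
\<close>

definition topologically_transversal ::
  "('a \<times> real \<Rightarrow> 'a) \<Rightarrow> 'a topology \<Rightarrow> 'a set \<Rightarrow> bool" where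
  "topologically_transversal \<Phi> X S \<longleftrightarrow> S \<subseteq> topspace X \<and>
    (\<exists>n\<ge>1. manifold_of_dim n X \<and>
      (manifold_of_dim (n - 1) (subtopology X S) \<and> locally_flat (n - 1) n X S) \<and>
      (\<exists>\<delta>p \<delta>m :: 'a \<Rightarrow> real. \<forall>x\<in>S. \<exists>U \<phi>.
        openin X U \<and> x \<in> U \<and>
        homeomorphic_map (subtopology X U) (subtopology (Euclidean_space n) (unit_ball n)) \<phi> \<and>
        \<phi> ` (U \<inter> S) = unit_ball n \<inter> {v. v (n - 1) = 0} \<and>
        \<delta>p x > 0 \<and> \<delta>m x < 0 \<and>
        (\<exists>K L. K \<in> connected_components_of (subtopology X (U - S)) \<and>
          L \<in> connected_components_of (subtopology X (U - S)) \<and> K \<noteq> L \<and>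
          (\<lambda>t. \<Phi> (x, t)) ` {\<delta>m x..<0} \<subseteq> K \<and> (\<lambda>t. \<Phi> (x, t)) ` {0<..\<delta>p x} \<subseteq> L) \<and>
        (\<lambda>t. \<Phi> (x, t)) ` {\<delta>m x..\<delta>p x} \<inter> S = {x} \<and>
        (\<exists>V \<delta>. openin X V \<and> x \<in> V \<and> V \<subseteq> U \<and> \<delta> > 0 \<and>
          (\<forall>y\<in>V \<inter> S. \<delta>p y > \<delta> \<and> \<delta>m y < - \<delta>))) \<and>
      (\<forall>y\<in>topspace X. \<forall>a b. compactin (subtopology X S) ((\<lambda>t. \<Phi> (y, t)) ` {a..b} \<inter> S)))"

definition global_poincare_section ::
  "('a \<times> real \<Rightarrow> 'a) \<Rightarrow> 'a topology \<Rightarrow> 'a set \<Rightarrow> bool" where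
  "global_poincare_section \<Phi> X S \<longleftrightarrow> topologically_transversal \<Phi> X S \<and>
    (\<forall>x\<in>topspace X. (\<exists>t>0. \<Phi> (x, t) \<in> S) \<and> (\<exists>t<0. \<Phi> (x, t) \<in> S))"

type_synonym 'a flowgs_obj = "('a \<times> real \<Rightarrow> 'a) \<times> 'a topology \<times> 'a set"

definition FlowGS_cat :: "('a flowgs_obj, 'a \<Rightarrow> 'a) precategory" where
  "FlowGS_cat = \<lparr>
     Obj = {(\<Phi>, X, S). flow \<Phi> X \<and> global_poincare_section \<Phi> X S},
     Hom = (\<lambda>(\<Phi>, X, S) (\<Psi>, Y, S'). {h. flow_morphism \<Phi> X \<Psi> Y h \<and>
              S = {x \<in> topspace X. h x \<in> S'}}),
     Ident = (\<lambda>(\<Phi>, X, S). \<lambda>x\<in>topspace X. x),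
     Comp = (\<lambda>(\<Phi>, X, S) _ _ k h. compose (topspace X) k h)\<rparr>"


section \<open>Mapping torus and suspension flow\<close>

definition quotient_topology :: "'a topology \<Rightarrow> ('a \<times> 'a) set \<Rightarrow> 'a set topology" where
  "quotient_topology T r =
    topology (\<lambda>U. U \<subseteq> topspace T // r \<and> openin T {x \<in> topspace T. r `` {x} \<in> U})"

lemma openin_quotient_topology:
  "openin (quotient_topology T r) U \<longleftrightarrow>
    U \<subseteq> topspace T // r \<and> openin T {x \<in> topspace T. r `` {x} \<in> U}"
proof -
  have "istopology (\<lambda>U. U \<subseteq> topspace T // r \<and> openin T {x \<in> topspace T. r `` {x} \<in> U})"
    unfolding istopology_def
  proof (intro conjI allI impI)
    fix U V
    assume U: "U \<subseteq> topspace T // r \<and> openin T {x \<in> topspace T. r `` {x} \<in> U}"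
      and V: "V \<subseteq> topspace T // r \<and> openin T {x \<in> topspace T. r `` {x} \<in> V}"
    have "{x \<in> topspace T. r `` {x} \<in> U \<inter> V} =
        {x \<in> topspace T. r `` {x} \<in> U} \<inter> {x \<in> topspace T. r `` {x} \<in> V}" by auto
    with U V show "openin T {x \<in> topspace T. r `` {x} \<in> U \<inter> V}" by (simp add: openin_Int)
    from U show "U \<inter> V \<subseteq> topspace T // r" by blast
  next
    fix \<K>
    assume K: "\<forall>U\<in>\<K>. U \<subseteq> topspace T // r \<and> openin T {x \<in> topspace T. r `` {x} \<in> U}"
    have "{x \<in> topspace T. r `` {x} \<in> \<Union>\<K>} = (\<Union>U\<in>\<K>. {x \<in> topspace T. r `` {x} \<in> U})"
      by auto
    with K show "openin T {x \<in> topspace T. r `` {x} \<in> \<Union>\<K>}" by auto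
    from K show "\<Union>\<K> \<subseteq> topspace T // r" by blast
  qed
  then show ?thesis by (simp add: quotient_topology_def topology_inverse')
qed

lemma topspace_quotient_topology: "topspace (quotient_topology T r) = topspace T // r"
proof
  show "topspace (quotient_topology T r) \<subseteq> topspace T // r"
    by (metis openin_quotient_topology openin_topspace)
  have "{x \<in> topspace T. r `` {x} \<in> topspace T // r} = topspace T"
    by (auto intro: quotientI)
  then show "topspace T // r \<subseteq> topspace (quotient_topology T r)"
    by (intro openin_subset) (simp add: openin_quotient_topology)
qed

lemma quotient_map_quotient_topology:
  "quotient_map T (quotient_topology T r) (\<lambda>x. r `` {x})"
  unfolding quotient_map_def topspace_quotient_topology openin_quotient_topology
  by (auto simp: quotient_def)

text \<open>The smallest equivalence relation on \<open>X \<times> [0,1]\<close> with \<open>(x,1) \<sim> (f x,0)\<close>.\<close>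

definition torus_rel :: "('a \<Rightarrow> 'a) \<Rightarrow> 'a topology \<Rightarrow> (('a \<times> real) \<times> ('a \<times> real)) set" where
  "torus_rel f X =
    \<Inter>{r. equiv (topspace X \<times> {0..1}) r \<and> (\<forall>x\<in>topspace X. ((x, 1), (f x, 0)) \<in> r)}"

definition mapping_torus :: "('a \<Rightarrow> 'a) \<Rightarrow> 'a topology \<Rightarrow> ('a \<times> real) set topology" where
  "mapping_torus f X = quotient_topology (prod_topology X (top_of_set {0..1})) (torus_rel f X)"

text \<open>The class \<open>[x,t]\<close>.\<close>

definition torus_point :: "('a \<Rightarrow> 'a) \<Rightarrow> 'a topology \<Rightarrow> 'a \<Rightarrow> real \<Rightarrow> ('a \<times> real) set" where
  "torus_point f X x t = torus_rel f X `` {(x, t)}"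

definition torus_zero_section :: "('a \<Rightarrow> 'a) \<Rightarrow> 'a topology \<Rightarrow> ('a \<times> real) set set" where
  "torus_zero_section f X = {torus_point f X x 0 | x. x \<in> topspace X}"

definition int_iterate :: "('a \<Rightarrow> 'a) \<Rightarrow> 'a topology \<Rightarrow> int \<Rightarrow> 'a \<Rightarrow> 'a" where
  "int_iterate f X n =
    (if n \<ge> 0 then f ^^ nat n else inv_into (topspace X) f ^^ nat (- n))"

text \<open>
  The integer \<open>n\<close> with \<open>s + t - 1 < n \<le> s + t\<close> is \<open>\<lfloor>s + t\<rfloor>\<close>. The lemma
  \<open>suspension_flow_point\<close> below shows that the description is a legitimate one.
\<close>

definition suspension_flow ::
  "('a \<Rightarrow> 'a) \<Rightarrow> 'a topology \<Rightarrow> ('a \<times> real) set \<times> real \<Rightarrow> ('a \<times> real) set" where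
  "suspension_flow f X =
    (\<lambda>(p, s) \<in> topspace (mapping_torus f X) \<times> UNIV.
      THE q. \<exists>x\<in>topspace X. \<exists>t\<in>{0..<1}. p = torus_point f X x t \<and>
        q = torus_point f X (int_iterate f X \<lfloor>s + t\<rfloor> x) (s + t - of_int \<lfloor>s + t\<rfloor>))"

lemma equiv_torus_rel:
  assumes "f \<in> topspace X \<rightarrow> topspace X"
  shows "equiv (topspace X \<times> {0..1}) (torus_rel f X)"
proof -
  let ?A = "topspace X \<times> {0..1::real}"
  have full: "equiv ?A (?A \<times> ?A)" by (auto simp: equiv_def refl_on_def sym_def trans_def)
  with assms have "torus_rel f X \<subseteq> ?A \<times> ?A" unfolding torus_rel_def by (intro Inter_lower) auto
  moreover have "refl_on ?A (torus_rel f X)"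
    using \<open>torus_rel f X \<subseteq> ?A \<times> ?A\<close> unfolding torus_rel_def
    by (auto simp: equiv_def refl_on_def)
  moreover have "sym (torus_rel f X)"
    unfolding torus_rel_def by (auto simp: equiv_def intro!: symI dest: symD)
  moreover have "trans (torus_rel f X)"
    unfolding torus_rel_def by (rule transI) (auto simp: equiv_def dest: transD)
  ultimately show ?thesis by (simp add: equiv_def)
qed

lemma torus_point_eq_iff:
  assumes f: "f \<in> topspace X \<rightarrow> topspace X"
    and x: "x \<in> topspace X" "0 \<le> t" "t < 1" and y: "y \<in> topspace X" "0 \<le> u" "u < 1"
  shows "torus_point f X x t = torus_point f X y u \<longleftrightarrow> x = y \<and> t = u"
proof
  let ?A = "topspace X \<times> {0..1::real}"
  define nf where "nf = (\<lambda>(x, t::real). if t = 1 then (f x, 0) else (x, t))"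
  define r where "r = {(p, q). p \<in> ?A \<and> q \<in> ?A \<and> nf p = nf q}"
  have "equiv ?A r" unfolding r_def equiv_def refl_on_def sym_def trans_def by auto
  moreover have "\<forall>x\<in>topspace X. ((x, 1), (f x, 0)) \<in> r"
    using f by (auto simp: r_def nf_def)
  ultimately have sub: "torus_rel f X \<subseteq> r" unfolding torus_rel_def by (intro Inter_lower) auto
  assume "torus_point f X x t = torus_point f X y u"
  then have "((x, t), (y, u)) \<in> torus_rel f X"
    using equiv_torus_rel[OF f] y unfolding torus_point_def by (simp add: eq_equiv_class)
  with sub have "nf (x, t) = nf (y, u)" unfolding r_def by auto
  with x y show "x = y \<and> t = u" by (auto simp: nf_def split: if_splits)
qed simp

lemma suspension_flow_point:
  assumes f: "f \<in> topspace X \<rightarrow> topspace X"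
    and x: "x \<in> topspace X" "0 \<le> t" "t < 1"
    and n: "s + t - 1 < of_int n" "of_int n \<le> s + t"
  shows "suspension_flow f X (torus_point f X x t, s) =
    torus_point f X (int_iterate f X n x) (s + t - of_int n)"
proof -
  have n_eq: "\<lfloor>s + t\<rfloor> = n" using n by linarith
  have top: "torus_point f X x t \<in> topspace (mapping_torus f X)"
    using x by (auto simp: mapping_torus_def topspace_quotient_topology torus_point_def
        intro!: quotientI)
  have "(THE q. \<exists>x'\<in>topspace X. \<exists>t'\<in>{0..<1}. torus_point f X x t = torus_point f X x' t' \<and>
      q = torus_point f X (int_iterate f X \<lfloor>s + t'\<rfloor> x') (s + t' - of_int \<lfloor>s + t'\<rfloor>)) =
    torus_point f X (int_iterate f X n x) (s + t - of_int n)"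
    using x n_eq by (intro the_equality) (force simp: torus_point_eq_iff[OF f])+
  with top show ?thesis by (simp add: suspension_flow_def)
qed

end

theory Submission
  imports Defs
begin

text \<open>
  The mapping torus is best seen as the orbit space of the cylinder \<open>X \<times> \<real>\<close> under the action of
  \<open>\<int>\<close> generated by \<open>(x, t) \<mapsto> (f x, t - 1)\<close>. The projection \<open>torus_proj\<close> of the cylinder onto
  \<open>X\<^sub>f\<close> is the identification map of \<open>X \<times> [0,1]\<close> on each slab \<open>X \<times> [n, n + 1]\<close>, after translation
  by \<open>n\<close>; two points of the cylinder have the same image exactly if they lie in the same orbit
  (\<open>proj_eq_iff\<close>). It is continuous because these slabs form a locally finite closed cover, and it is
  open because the saturation of an open set is a union of translates
  (\<open>continuous_map_proj\<close>, \<open>open_map_proj\<close>). It is injective on slabs \<open>X \<times> J\<close> over open intervals \<open>J\<close>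
  of length one. Hence it is a local homeomorphism, and everything local about \<open>X\<^sub>f\<close> can be read off
  from \<open>X \<times> \<real>\<close>.

  In this picture the suspension flow is translation of the second coordinate,
  \<open>[x, t] \<mapsto> [x, t + s]\<close>, the section is the image of \<open>X \<times> \<int>\<close>, and the map induced by an equivariant \<open>h\<close> is
  \<open>[x, t] \<mapsto> [h x, t]\<close>; here \<open>[x, t]\<close> stands for the image of \<open>(x, t)\<close> with \<open>t\<close> an arbitrary real. The
  flow laws, equivariance, \<open>S = h\<^sup>-\<^sup>1(S')\<close> and functoriality become immediate, and continuity passes
  down through the quotient map.

  For the section, the product of a chart of \<open>X\<close> at \<open>x\<close> with an interval around \<open>0\<close> gives a chart of \<open>X\<^sub>f\<close> at
  \<open>[x, 0]\<close> whose last coordinate has the sign of the time (\<open>section_chart\<close>). This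
  one chart yields the manifold structure of the section, its local flatness and, after a radial
  homeomorphism of \<open>\<real>\<^sup>n\<close> onto the unit ball, the crossing condition: the two half orbits lie on
  different sides because a connected set meeting both signs of the last coordinate meets its zero
  set (\<open>section_0_separates\<close>). Every orbit meets the section at the discrete set of times at which
  the second coordinate is an integer, which gives the compactness condition and the return times.
\<close>

section \<open>Euclidean spaces, balls and charts\<close>

lemma continuous_map_Euclidean_space_coordinate:
  "continuous_map (Euclidean_space n) euclideanreal (\<lambda>v. v i)"
  unfolding Euclidean_space_def
  by (intro continuous_map_from_subtopology continuous_map_product_projection) simp

lemma continuous_map_into_Euclidean_space_iff:
  "continuous_map X (Euclidean_space n) f \<longleftrightarrow>
    (\<forall>i. continuous_map X euclideanreal (\<lambda>x. f x i)) \<and> (\<forall>x\<in>topspace X. \<forall>i\<ge>n. f x i = 0)"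
  unfolding Euclidean_space_def continuous_map_in_subtopology continuous_map_componentwise_UNIV
  by auto

lemma continuous_map_L2_set_Euclidean_space:
  "continuous_map (Euclidean_space n) euclideanreal (\<lambda>v. L2_set v {..<k})"
  unfolding L2_set_def
  by (intro continuous_intros continuous_map_Euclidean_space_coordinate) auto

lemma unit_ball_altdef: "unit_ball n = {v \<in> topspace (Euclidean_space n). L2_set v {..<n} < 1}"
  by (simp add: unit_ball_def L2_set_def)

lemma openin_unit_ball: "openin (Euclidean_space n) (unit_ball n)"
proof -
  have "openin (Euclidean_space n)
      {v \<in> topspace (Euclidean_space n). L2_set v {..<n} \<in> {..<1}}"
    by (rule openin_continuous_map_preimage[OF continuous_map_L2_set_Euclidean_space]) auto
  then show ?thesis by (simp add: unit_ball_altdef)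
qed

lemma L2_set_scale: "L2_set (\<lambda>i. v i / c) A = L2_set v A / \<bar>c\<bar>"
  using L2_set_right_distrib[of "\<bar>1 / c\<bar>" v A]
  by (simp add: L2_set_def power_mult_distrib power_divide)

text \<open>
  The radial homeomorphism \<open>v \<mapsto> v / (1 + \<bar>v\<bar>)\<close>, with inverse \<open>w \<mapsto> w / (1 - \<bar>w\<bar>)\<close>. Since it rescales
  each vector by a positive factor, it preserves the coordinate hyperplanes; this is how a chart
  onto \<open>\<real>\<^sup>n\<close> adapted to the section becomes a chart onto the ball adapted to it.
\<close>

lemma homeomorphic_map_Euclidean_space_unit_ball:
  "homeomorphic_map (Euclidean_space n) (subtopology (Euclidean_space n) (unit_ball n))
     (\<lambda>v i. v i / (1 + L2_set v {..<n}))"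
proof -
  have pos: "1 + L2_set v {..<n} > 0" for v :: "nat \<Rightarrow> real"
    by (simp add: add_pos_nonneg L2_set_nonneg)
  then have nz: "1 + L2_set v {..<n} \<noteq> 0" for v :: "nat \<Rightarrow> real"
    by (metis less_irrefl)
  have "homeomorphic_maps (Euclidean_space n) (subtopology (Euclidean_space n) (unit_ball n))
     (\<lambda>v i. v i / (1 + L2_set v {..<n})) (\<lambda>w i. w i / (1 - L2_set w {..<n}))"
    unfolding homeomorphic_maps_def
  proof (intro conjI ballI)
    show "continuous_map (Euclidean_space n) (subtopology (Euclidean_space n) (unit_ball n))
        (\<lambda>v i. v i / (1 + L2_set v {..<n}))"
      unfolding continuous_map_in_subtopology continuous_map_into_Euclidean_space_iff
      apply (intro conjI allI ballI impI continuous_intros continuous_map_L2_set_Euclidean_space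
          continuous_map_Euclidean_space_coordinate)
        apply (use nz in \<open>auto simp: unit_ball_altdef topspace_Euclidean_space L2_set_scale\<close>)
      using pos by (simp add: divide_less_eq)
    show "continuous_map (subtopology (Euclidean_space n) (unit_ball n)) (Euclidean_space n)
        (\<lambda>w i. w i / (1 - L2_set w {..<n}))"
      unfolding continuous_map_into_Euclidean_space_iff
      apply (intro conjI allI ballI impI continuous_intros
          continuous_map_from_subtopology[OF continuous_map_L2_set_Euclidean_space]
          continuous_map_from_subtopology[OF continuous_map_Euclidean_space_coordinate])
      by (auto simp: unit_ball_altdef topspace_Euclidean_space)
  next
    fix v assume "v \<in> topspace (Euclidean_space n)"
    show "(\<lambda>i. (v i / (1 + L2_set v {..<n})) /
        (1 - L2_set (\<lambda>i. v i / (1 + L2_set v {..<n})) {..<n})) = v"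
      using pos[of v] by (auto simp: L2_set_scale field_simps)
  next
    fix w assume "w \<in> topspace (subtopology (Euclidean_space n) (unit_ball n))"
    then have "1 - L2_set w {..<n} > 0" by (auto simp: unit_ball_altdef)
    then show "(\<lambda>i. (w i / (1 - L2_set w {..<n})) /
        (1 + L2_set (\<lambda>i. w i / (1 - L2_set w {..<n})) {..<n})) = w"
      by (auto simp: L2_set_scale field_simps)
  qed
  then show ?thesis by (rule homeomorphic_maps_imp_map)
qed

text \<open>
  An open interval of length one is what the projection to the mapping torus leaves intact. This
  identification with the line is chosen so that the sign of \<open>u\<close> tells the side of the midpoint.
\<close>

lemma homeomorphic_map_euclideanreal_interval:
  "homeomorphic_map euclideanreal (top_of_set {s - 1/2<..<s + 1/2}) (\<lambda>u. s + u / (2 * (1 + \<bar>u\<bar>)))"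
proof -
  have "homeomorphic_maps euclideanreal (top_of_set {s - 1/2<..<s + 1/2})
      (\<lambda>u. s + u / (2 * (1 + \<bar>u\<bar>))) (\<lambda>t. 2 * (t - s) / (1 - 2 * \<bar>t - s\<bar>))"
    unfolding homeomorphic_maps_def
  proof (intro conjI ballI)
    have ne: "1 + \<bar>u\<bar> \<noteq> 0" for u :: real by linarith
    have "\<bar>u / (2 * (1 + \<bar>u\<bar>))\<bar> < 1/2" for u :: real
      by (simp add: abs_divide abs_mult field_simps)
    then have "s - 1/2 < s + u / (2 * (1 + \<bar>u\<bar>)) \<and> s + u / (2 * (1 + \<bar>u\<bar>)) < s + 1/2" for u :: real
      by (smt (verit))
    then show "continuous_map euclideanreal (top_of_set {s - 1/2<..<s + 1/2}) (\<lambda>u. s + u / (2 * (1 + \<bar>u\<bar>)))"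
      unfolding continuous_map_in_subtopology
      using ne by (auto intro!: continuous_intros)
    have "1 - 2 * \<bar>t - s\<bar> \<noteq> 0" if "s - 1/2 < t" "t < s + 1/2" for t
      using that by (auto simp: abs_if)
    then show "continuous_map (top_of_set {s - 1/2<..<s + 1/2}) euclideanreal (\<lambda>t. 2 * (t - s) / (1 - 2 * \<bar>t - s\<bar>))"
      by (auto intro!: continuous_intros)
  next
    fix u :: real
    have "1 + \<bar>u\<bar> > 0" by linarith
    then show "2 * (s + u / (2 * (1 + \<bar>u\<bar>)) - s) / (1 - 2 * \<bar>s + u / (2 * (1 + \<bar>u\<bar>)) - s\<bar>) = u"
      by (simp add: abs_divide abs_mult field_simps)
  next
    fix t assume t: "t \<in> topspace (top_of_set {s - 1/2<..<s + 1/2})"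
    define d where "d = t - s"
    have "1 - 2 * \<bar>d\<bar> > 0" using t by (auto simp: d_def abs_if)
    then have "s + 2 * d / (1 - 2 * \<bar>d\<bar>) / (2 * (1 + \<bar>2 * d / (1 - 2 * \<bar>d\<bar>)\<bar>)) = s + d"
      by (simp add: abs_divide abs_mult field_simps)
    then show "s + 2 * (t - s) / (1 - 2 * \<bar>t - s\<bar>) / (2 * (1 + \<bar>2 * (t - s) / (1 - 2 * \<bar>t - s\<bar>)\<bar>)) = t"
      by (simp add: d_def)
  qed
  then show ?thesis by (rule homeomorphic_maps_imp_map)
qed

lemma homeomorphic_map_Euclidean_space_Suc:
  "homeomorphic_map (Euclidean_space (Suc m)) (prod_topology (Euclidean_space m) euclideanreal)
     (\<lambda>v. (v(m := 0), v m))"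
proof -
  have "homeomorphic_maps (Euclidean_space (Suc m)) (prod_topology (Euclidean_space m) euclideanreal)
     (\<lambda>v. (v(m := 0), v m)) (\<lambda>(v, u). v(m := u))"
    unfolding homeomorphic_maps_def
  proof (intro conjI ballI)
    show "continuous_map (Euclidean_space (Suc m)) (prod_topology (Euclidean_space m) euclideanreal)
        (\<lambda>v. (v(m := 0), v m))"
      by (auto simp: continuous_map_pairwise o_def continuous_map_into_Euclidean_space_iff fun_upd_def
          topspace_Euclidean_space
          intro!: continuous_map_Euclidean_space_coordinate)
    have fst: "continuous_map (prod_topology (Euclidean_space m) euclideanreal) euclideanreal (\<lambda>p. fst p i)"
      for i
      using continuous_map_compose[OF continuous_map_fst continuous_map_Euclidean_space_coordinate]
      by (simp add: o_def)
    show "continuous_map (prod_topology (Euclidean_space m) euclideanreal) (Euclidean_space (Suc m))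
        (\<lambda>(v, u). v(m := u))"
      unfolding continuous_map_into_Euclidean_space_iff
      using fst by (auto simp: case_prod_unfold topspace_Euclidean_space fun_upd_def continuous_map_snd)
  qed (auto simp: topspace_Euclidean_space)
  then show ?thesis by (rule homeomorphic_maps_imp_map)
qed

text \<open>
  The topology is that of pointwise convergence, so a basic neighbourhood bounds coordinates
  separately. Only the first \<open>n\<close> coordinates can vary, and the smallest of these finitely many
  bounds is a radius that works.
\<close>

lemma openin_Euclidean_space_contains_ball:
  assumes "openin (Euclidean_space n) W" "p \<in> W"
  obtains r where "r > 0" "\<And>v. v \<in> topspace (Euclidean_space n) \<Longrightarrow> L2_set (\<lambda>i. v i - p i) {..<n} < r \<Longrightarrow> v \<in> W"
proof -
  obtain T where T: "openin (powertop_real UNIV) T" "W = T \<inter> {x. \<forall>i\<ge>n. x i = 0}"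
    using assms by (auto simp: Euclidean_space_def openin_subtopology)
  obtain V where V: "p \<in> (\<Pi>\<^sub>E i\<in>UNIV. V i)" "\<And>i. openin euclideanreal (V i)" "(\<Pi>\<^sub>E i\<in>UNIV. V i) \<subseteq> T"
    using product_topology_open_contains_basis[OF T(1)] assms T(2) by blast
  have "\<exists>e>0. ball (p i) e \<subseteq> V i" for i
    using V by (metis PiE_UNIV_domain Pi_iff UNIV_I open_contains_ball open_openin)
  then obtain e where e: "\<And>i. e i > 0" "\<And>i. ball (p i) (e i) \<subseteq> V i" by metis
  define r where "r = Min (insert 1 (e ` {..<n}))"
  have r: "r \<le> e i" if "i < n" for i using that by (simp add: r_def)
  show thesis
  proof
    show "r > 0" using e by (simp add: r_def)
    fix v assume v: "v \<in> topspace (Euclidean_space n)" "L2_set (\<lambda>i. v i - p i) {..<n} < r"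
    have "v i \<in> V i" for i
    proof (cases "i < n")
      case True
      have "\<bar>v i - p i\<bar> \<le> L2_set (\<lambda>i. v i - p i) {..<n}"
        using member_le_L2_set[of "{..<n}" i "\<lambda>i. \<bar>v i - p i\<bar>"] True by (simp add: L2_set_def)
      then have "v i \<in> ball (p i) (e i)" using r[OF True] v by (simp add: dist_real_def abs_minus_commute)
      then show ?thesis using e by blast
    next
      case False
      then have "v i = p i" using v assms T by (auto simp: topspace_Euclidean_space)
      then show ?thesis using V(1) by (auto simp: PiE_iff)
    qed
    then show "v \<in> W" using V(3) v T by (auto simp: topspace_Euclidean_space PiE_iff)
  qed
qed

lemma homeomorphic_map_Euclidean_space_affine:
  assumes "p \<in> topspace (Euclidean_space n)" "r \<noteq> 0"
  shows "homeomorphic_map (Euclidean_space n) (Euclidean_space n) (\<lambda>v i. p i + r * v i)"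
proof -
  have "homeomorphic_maps (Euclidean_space n) (Euclidean_space n)
     (\<lambda>v i. p i + r * v i) (\<lambda>v i. (v i - p i) / r)"
    unfolding homeomorphic_maps_def continuous_map_into_Euclidean_space_iff
    using assms by (auto simp: topspace_Euclidean_space
        intro!: continuous_intros continuous_map_Euclidean_space_coordinate)
  then show ?thesis by (rule homeomorphic_maps_imp_map)
qed

text \<open>
  Charts of a manifold have arbitrary open sets as images; shrinking one to a ball, which is
  homeomorphic to \<open>\<real>\<^sup>n\<close>, makes the domain of the inverse chart the whole of \<open>\<real>\<^sup>n\<close>, as local
  flatness demands, and products of such parametrizations are again defined on a whole space.
\<close>

lemma manifold_of_dim_imp_Euclidean_parametrization:
  assumes "manifold_of_dim n X" "x \<in> topspace X"
  obtains U g where "openin X U" "x \<in> U" "homeomorphic_map (Euclidean_space n) (subtopology X U) g"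
proof -
  let ?E = "Euclidean_space n"
  obtain U W where U: "openin X U" "x \<in> U" and W: "openin ?E W"
    and "subtopology X U homeomorphic_space subtopology ?E W"
    using assms unfolding manifold_of_dim_def by blast
  then obtain k where "homeomorphic_map (subtopology ?E W) (subtopology X U) k"
    using homeomorphic_space homeomorphic_space_sym by blast
  moreover have [simp]: "U \<subseteq> topspace X" "W \<subseteq> topspace ?E"
    using U W openin_subset by blast+
  ultimately have k: "homeomorphic_map (subtopology ?E W) (subtopology X U) k" "k ` W = U"
    using homeomorphic_imp_surjective_map
    by (fastforce simp: topspace_subtopology_subset)+
  then obtain p where p: "p \<in> W" "k p = x" using U by blast
  obtain r where r: "r > 0" "\<And>v. v \<in> topspace ?E \<Longrightarrow> L2_set (\<lambda>i. v i - p i) {..<n} < r \<Longrightarrow> v \<in> W"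
    using openin_Euclidean_space_contains_ball[OF W p(1)] by metis
  define a where "a = (\<lambda>(v :: nat \<Rightarrow> real) i. p i + r * v i)"
  have pE: "p \<in> topspace ?E" using p \<open>W \<subseteq> topspace ?E\<close> by blast
  have a: "homeomorphic_map ?E ?E a"
    unfolding a_def by (rule homeomorphic_map_Euclidean_space_affine) (use r pE in auto)
  define B where "B = a ` unit_ball n"
  have ub: "unit_ball n \<subseteq> topspace ?E" using openin_unit_ball openin_subset by blast
  have Bopen: "openin ?E B"
    unfolding B_def using a homeomorphic_imp_open_map open_map_def openin_unit_ball by blast
  have BW: "B \<subseteq> W"
  proof
    fix w assume "w \<in> B"
    then obtain v where v: "v \<in> unit_ball n" "w = a v" by (auto simp: B_def)
    have "L2_set (\<lambda>i. w i - p i) {..<n} = r * L2_set v {..<n}"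
      using r by (simp add: v a_def L2_set_right_distrib)
    also have "\<dots> < r" using v r by (simp add: unit_ball_altdef)
    finally show "w \<in> W"
      using r(2) \<open>w \<in> B\<close> Bopen openin_subset by blast
  qed
  have a': "homeomorphic_map (subtopology ?E (unit_ball n)) (subtopology ?E B) a"
    by (rule homeomorphic_map_subtopologies[OF a])
      (use ub openin_subset[OF Bopen] in \<open>auto simp: B_def\<close>)
  have "k ` B \<subseteq> U" using BW k(2) by blast
  then have k': "homeomorphic_map (subtopology ?E B) (subtopology X (k ` B)) k"
    using homeomorphic_map_subtopologies[OF k(1), of B "k ` B"] BW
    by (simp add: subtopology_subtopology topspace_subtopology_subset Int_absorb1)
  have "homeomorphic_map ?E (subtopology X (k ` B)) (k \<circ> (a \<circ> (\<lambda>v i. v i / (1 + L2_set v {..<n}))))"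
    by (rule homeomorphic_map_compose[OF homeomorphic_map_compose[OF
        homeomorphic_map_Euclidean_space_unit_ball a'] k'])
  moreover have "openin X (k ` B)"
  proof -
    have "openin (subtopology ?E W) B" using Bopen BW by (simp add: openin_subset_topspace_eq openin_subtopology) blast
    then have "openin (subtopology X U) (k ` B)"
      using k homeomorphic_imp_open_map open_map_def by blast
    then show ?thesis using U openin_trans_full by blast
  qed
  moreover have "x \<in> k ` B"
  proof -
    have "(\<lambda>i. 0) \<in> unit_ball n" by (simp add: unit_ball_def topspace_Euclidean_space)
    then have "a (\<lambda>i. 0) \<in> B" unfolding B_def by blast
    moreover have "a (\<lambda>i. 0) = p" by (simp add: a_def)
    ultimately show ?thesis using p by blast
  qed
  ultimately show thesis using that by blast
qed

lemma subtopology_Euclidean_space_hyperplane: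
  "subtopology (Euclidean_space (Suc m)) {v. v m = 0} = Euclidean_space m"
proof -
  have "{v. \<forall>i\<ge>Suc m. v i = 0} \<inter> {v. v m = 0} = {v::nat \<Rightarrow> real. \<forall>i\<ge>m. v i = 0}"
    by (auto simp: Suc_le_eq) (metis le_neq_implies_less)
  then show ?thesis by (simp add: Euclidean_space_def subtopology_subtopology)
qed

section \<open>General topology\<close>

lemma second_countable_euclideanreal: "second_countable euclideanreal"
proof -
  obtain B :: "real set set" where "countable B" "topological_basis B"
    using ex_countable_basis by blast
  then show ?thesis
    unfolding second_countable_def by (metis open_openin topological_basis_def topological_basisE)
qed

lemma second_countable_prod_topology:
  assumes "second_countable X" "second_countable Y"
  shows "second_countable (prod_topology X Y)"
proof -
  obtain \<A> \<B> where A: "countable \<A>" "\<And>V. V \<in> \<A> \<Longrightarrow> openin X V"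
      "\<And>U x. openin X U \<Longrightarrow> x \<in> U \<Longrightarrow> \<exists>V\<in>\<A>. x \<in> V \<and> V \<subseteq> U"
    and B: "countable \<B>" "\<And>V. V \<in> \<B> \<Longrightarrow> openin Y V"
      "\<And>U x. openin Y U \<Longrightarrow> x \<in> U \<Longrightarrow> \<exists>V\<in>\<B>. x \<in> V \<and> V \<subseteq> U"
    using assms unfolding second_countable_def by metis
  let ?C = "(\<lambda>(V, W). V \<times> W) ` (\<A> \<times> \<B>)"
  have "\<exists>V\<in>?C. p \<in> V \<and> V \<subseteq> U" if U: "openin (prod_topology X Y) U" "p \<in> U" for U p
  proof -
    obtain x y where p: "p = (x, y)" by fastforce
    then obtain U1 U2 where "openin X U1" "openin Y U2" "x \<in> U1" "y \<in> U2" "U1 \<times> U2 \<subseteq> U"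
      using U(1)[unfolded openin_prod_topology_alt, rule_format, of x y] U(2) by auto
    moreover from A(3)[OF this(1,3)] B(3)[OF this(2,4)]
    obtain V W where "V \<in> \<A>" "x \<in> V" "V \<subseteq> U1" "W \<in> \<B>" "y \<in> W" "W \<subseteq> U2"
      by auto
    ultimately show ?thesis using p by (intro bexI[of _ "V \<times> W"]) auto
  qed
  moreover have "countable ?C" using A B by auto
  moreover have "\<forall>V\<in>?C. openin (prod_topology X Y) V"
    using A B by (auto simp: openin_prod_Times_iff)
  ultimately show ?thesis unfolding second_countable_def by blast
qed

lemma image_Int_Collect:
  assumes "f ` A = B" "\<And>a. a \<in> A \<Longrightarrow> a \<in> S \<longleftrightarrow> P (f a)"
  shows "f ` (A \<inter> S) = B \<inter> {b. P b}"
  using assms by blast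

lemma continuous_map_compose_restrict:
  "continuous_map X Y h \<Longrightarrow> continuous_map Y Z k \<Longrightarrow> continuous_map X Z (compose (topspace X) k h)"
  by (rule continuous_map_eq[of _ _ "k \<circ> h"]) (auto simp: compose_def intro: continuous_map_compose)

lemma continuous_map_restrict_id: "continuous_map X X (\<lambda>x\<in>topspace X. x)"
  by (rule continuous_map_eq[OF continuous_map_id]) simp

section \<open>The mapping torus as an orbit space of the cylinder\<close>

text \<open>
  This is \<open>(x, t) \<mapsto> [x, t]\<close> for arbitrary real \<open>t\<close>: the point \<open>(x, t)\<close> is moved along its orbit
  under \<open>(x, t) \<mapsto> (f x, t - 1)\<close> to the representative with second coordinate in \<open>[0,1)\<close>.
\<close>

definition torus_proj :: "('a \<Rightarrow> 'a) \<Rightarrow> 'a topology \<Rightarrow> 'a \<times> real \<Rightarrow> ('a \<times> real) set" where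
  "torus_proj f X = (\<lambda>(x, t). torus_point f X (int_iterate f X \<lfloor>t\<rfloor> x) (t - of_int \<lfloor>t\<rfloor>))"

locale self_homeomorphism =
  fixes f :: "'a \<Rightarrow> 'a" and X :: "'a topology"
  assumes homeo: "homeomorphic_map X X f"
begin

abbreviation "iter \<equiv> int_iterate f X"
abbreviation "cylinder \<equiv> prod_topology X euclideanreal"
abbreviation "torus \<equiv> mapping_torus f X"
abbreviation "proj \<equiv> torus_proj f X"

lemma bij: "bij_betw f (topspace X) (topspace X)"
  using homeomorphic_imp_injective_map[OF homeo] homeomorphic_imp_surjective_map[OF homeo]
  by (simp add: bij_betw_def)

lemma maps: "f \<in> topspace X \<rightarrow> topspace X"
  using bij by (auto simp: bij_betw_def)

lemma iter_0 [simp]: "iter 0 x = x"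
  by (simp add: int_iterate_def)

lemma continuous_map_inverse: "continuous_map X X (inv_into (topspace X) f)"
proof -
  obtain g where g: "homeomorphic_maps X X f g" using homeo homeomorphic_map_maps by blast
  have "g y = inv_into (topspace X) f y" if "y \<in> topspace X" for y
  proof -
    have "g y \<in> topspace X" "f (g y) = y"
      using g that by (auto simp: homeomorphic_maps_def continuous_map_def)
    then show ?thesis using inv_into_f_f[OF bij_betw_imp_inj_on[OF bij], of "g y"] by simp
  qed
  moreover have "continuous_map X X g" using g by (simp add: homeomorphic_maps_def)
  ultimately show ?thesis by (rule continuous_map_eq[rotated])
qed

lemma continuous_map_iter: "continuous_map X X (iter n)"
proof -
  have "continuous_map X X (g ^^ k)" if "continuous_map X X g" for g :: "'a \<Rightarrow> 'a" and k
    by (induction k) (use that continuous_map_compose in \<open>auto simp del: o_apply\<close>)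
  then show ?thesis
    using homeo continuous_map_inverse homeomorphic_imp_continuous_map
    unfolding int_iterate_def by (metis (full_types))
qed

lemma iter_in [simp, intro]: "x \<in> topspace X \<Longrightarrow> iter n x \<in> topspace X"
  using continuous_map_iter[of n] by (auto simp: continuous_map_def)

text \<open>
  For negative \<open>n\<close> the iterates are those of \<open>inv_into (topspace X) f\<close>, so a step up
  cancels one inverse, which is possible because \<open>f\<close> is onto.
\<close>

lemma iter_succ: "x \<in> topspace X \<Longrightarrow> iter (n + 1) x = f (iter n x)"
proof (cases "n \<ge> 0")
  case True
  then have "nat (n + 1) = Suc (nat n)" by simp
  with True show ?thesis by (simp add: int_iterate_def)
next
  case False
  assume x: "x \<in> topspace X"
  define k where "k = nat (- (n + 1))"
  have k: "nat (- n) = Suc k" using False by (simp add: k_def)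
  have m: "iter (n + 1) x = (inv_into (topspace X) f ^^ k) x"
    using False by (auto simp: int_iterate_def k_def)
  then have "(inv_into (topspace X) f ^^ k) x \<in> f ` topspace X"
    using x iter_in bij by (metis bij_betw_def)
  with m False k show ?thesis by (simp add: int_iterate_def f_inv_into_f)
qed

lemma iter_add: "x \<in> topspace X \<Longrightarrow> iter (m + n) x = iter m (iter n x)"
proof (induction m rule: int_induct[where k = 0])
  case (step1 i)
  then show ?case using iter_succ[of x "i + n"] iter_succ[of "iter n x" i] by (simp add: algebra_simps)
next
  case (step2 i)
  have "f (iter (i - 1 + n) x) = f (iter (i - 1) (iter n x))"
    using step2 iter_succ[of x "i - 1 + n"] iter_succ[of "iter n x" "i - 1"] by (simp add: algebra_simps)
  then show ?case using step2 bij by (metis bij_betw_def inj_onD iter_in)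
qed simp

lemma torus_point_1:
  assumes "x \<in> topspace X"
  shows "torus_point f X x 1 = torus_point f X (f x) 0"
proof -
  have "((x, 1), (f x, 0)) \<in> torus_rel f X" using assms by (auto simp: torus_rel_def)
  then show ?thesis
    using equiv_class_eq[OF equiv_torus_rel[OF maps]] by (simp add: torus_point_def)
qed

lemma quotient_map_torus_point:
  "quotient_map (prod_topology X (top_of_set {0..1})) torus (\<lambda>(x, t). torus_point f X x t)"
  using quotient_map_quotient_topology[of "prod_topology X (top_of_set {0..1})" "torus_rel f X"]
  by (simp add: mapping_torus_def torus_point_def case_prod_unfold)

lemma topspace_torus: "topspace torus = (\<lambda>(x, t). torus_point f X x t) ` (topspace X \<times> {0..1})"
  using quotient_imp_surjective_map[OF quotient_map_torus_point] by simp

lemma proj_eq_torus_point: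
  assumes "x \<in> topspace X" "0 \<le> t" "t \<le> 1"
  shows "proj (x, t) = torus_point f X x t"
proof (cases "t = 1")
  case True
  then show ?thesis using assms torus_point_1 iter_succ[of x 0] by (simp add: torus_proj_def)
next
  case False
  then have "\<lfloor>t\<rfloor> = 0" using assms by linarith
  then show ?thesis by (simp add: torus_proj_def)
qed

lemma proj_deck:
  assumes "x \<in> topspace X"
  shows "proj (iter n x, t - of_int n) = proj (x, t)"
  using iter_add[OF assms, of "\<lfloor>t\<rfloor> - n" n] by (simp add: torus_proj_def)

text \<open>
  The fibres are the orbits of the \<open>\<int>\<close>-action: by uniqueness of the representative \<open>[x, t]\<close> with
  \<open>0 \<le> t < 1\<close>, equal images force equal fractional parts, and the difference of the integer parts is
  the group element.
\<close>

lemma proj_eq_iff: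
  assumes x: "x \<in> topspace X" and y: "y \<in> topspace X"
  shows "proj (x, s) = proj (y, t) \<longleftrightarrow> (\<exists>n::int. t = s - of_int n \<and> y = iter n x)"
proof
  assume "proj (x, s) = proj (y, t)"
  then have "iter \<lfloor>s\<rfloor> x = iter \<lfloor>t\<rfloor> y" "s - of_int \<lfloor>s\<rfloor> = t - of_int \<lfloor>t\<rfloor>"
    using torus_point_eq_iff[OF maps, of "iter \<lfloor>s\<rfloor> x" "s - of_int \<lfloor>s\<rfloor>" "iter \<lfloor>t\<rfloor> y" "t - of_int \<lfloor>t\<rfloor>"]
    by (auto simp: torus_proj_def x y floor_correct) linarith+
  moreover have "y = iter (- \<lfloor>t\<rfloor>) (iter \<lfloor>t\<rfloor> y)"
    using iter_add[OF y, of "- \<lfloor>t\<rfloor>" "\<lfloor>t\<rfloor>"] by simp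
  ultimately have "y = iter (\<lfloor>s\<rfloor> - \<lfloor>t\<rfloor>) x \<and> t = s - of_int (\<lfloor>s\<rfloor> - \<lfloor>t\<rfloor>)"
    using iter_add[OF x, of "- \<lfloor>t\<rfloor>" "\<lfloor>s\<rfloor>"] by simp
  then show "\<exists>n::int. t = s - of_int n \<and> y = iter n x" by blast
next
  assume "\<exists>n::int. t = s - of_int n \<and> y = iter n x"
  then show "proj (x, s) = proj (y, t)" using proj_deck[OF x] by metis
qed

lemma proj_in: "x \<in> topspace X \<Longrightarrow> proj (x, t) \<in> topspace torus"
  unfolding topspace_torus torus_proj_def
  by (auto intro!: image_eqI[of _ _ "(iter \<lfloor>t\<rfloor> x, t - of_int \<lfloor>t\<rfloor>)"]) linarith+

lemma proj_surj: "proj ` topspace cylinder = topspace torus"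
proof
  show "proj ` topspace cylinder \<subseteq> topspace torus" using proj_in by auto
  have "torus_point f X x t \<in> proj ` topspace cylinder" if "x \<in> topspace X" "0 \<le> t" "t \<le> 1" for x t
    using that by (auto simp flip: proj_eq_torus_point)
  then show "topspace torus \<subseteq> proj ` topspace cylinder" by (auto simp: topspace_torus)
qed

lemma torus_cases:
  assumes "p \<in> topspace torus"
  obtains x t where "x \<in> topspace X" "p = proj (x, t)"
proof -
  have "p \<in> proj ` (topspace X \<times> UNIV)" using assms proj_surj by simp
  with that show thesis by blast
qed

lemma continuous_map_deck:
  "continuous_map cylinder cylinder (\<lambda>(x, t). (iter n x, t - of_int n))"
proof -
  have "continuous_map cylinder X (iter n \<circ> fst)"
    using continuous_map_fst continuous_map_iter by (rule continuous_map_compose)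
  moreover have "continuous_map cylinder euclideanreal ((\<lambda>t. t - of_int n) \<circ> snd)"
    by (rule continuous_map_compose[OF continuous_map_snd]) (auto intro: continuous_intros)
  ultimately show ?thesis
    unfolding case_prod_unfold by (auto simp: o_def intro: continuous_map_pairedI)
qed

text \<open>
  On the slab \<open>X \<times> [n, n + 1]\<close> the projection is translation by \<open>n\<close> followed by the identification map
  of \<open>X \<times> [0,1]\<close>; at the right end of the slab this uses \<open>[x, 1] = [f x, 0]\<close>.
\<close>

lemma continuous_map_proj: "continuous_map cylinder torus proj"
proof (rule pasting_lemma_locally_finite[where I = "UNIV :: int set"
      and T = "\<lambda>n. topspace X \<times> {of_int n..of_int n + 1}" and f = "\<lambda>_. proj"])
  fix n :: int
  show "closedin cylinder (topspace X \<times> {of_int n..of_int n + 1})"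
    by (simp add: closedin_prod_Times_iff)
  let ?A = "topspace X \<times> {of_int n..of_int n + 1 :: real}"
  have "continuous_map (subtopology cylinder ?A) (prod_topology X (top_of_set {0..1}))
      (\<lambda>(x, t). (iter n x, t - of_int n))"
    unfolding prod_topology_subtopology(2) continuous_map_in_subtopology
    by (auto intro: continuous_map_from_subtopology[OF continuous_map_deck])
  then have "continuous_map (subtopology cylinder ?A) torus
      ((\<lambda>(x, t). torus_point f X x t) \<circ> (\<lambda>(x, t). (iter n x, t - of_int n)))"
    using continuous_map_compose quotient_imp_continuous_map[OF quotient_map_torus_point] by blast
  moreover have "torus_point f X (iter n x) (t - of_int n) = proj (x, t)"
    if "x \<in> topspace X" "of_int n \<le> t" "t \<le> of_int n + 1" for x t
    using that proj_eq_torus_point[of "iter n x" "t - of_int n"] proj_deck by simp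
  ultimately show "continuous_map (subtopology cylinder ?A) torus proj"
    by (elim continuous_map_eq) auto
next
  fix p assume p: "p \<in> topspace cylinder"
  obtain x t where [simp]: "p = (x, t)" by fastforce
  let ?V = "topspace X \<times> {t - 1<..<t + 1}"
  \<comment> \<open>The slabs form a locally finite family.\<close>
  have "{n::int. topspace X \<times> {of_int n..of_int n + 1} \<inter> ?V \<noteq> {}} \<subseteq> {\<lfloor>t\<rfloor> - 2..\<lfloor>t\<rfloor> + 2}"
    by auto linarith+
  then have "finite {n::int. topspace X \<times> {of_int n..of_int n + 1} \<inter> ?V \<noteq> {}}"
    using finite_subset by blast
  moreover have "openin cylinder ?V" by (simp add: openin_prod_Times_iff)
  ultimately show "\<exists>V. openin cylinder V \<and> p \<in> V \<and>
      finite {n \<in> UNIV. topspace X \<times> {of_int n..of_int n + 1} \<inter> V \<noteq> {}}"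
    using p by (intro exI[of _ ?V]) auto
  have "real_of_int \<lfloor>t\<rfloor> \<le> t \<and> t \<le> real_of_int \<lfloor>t\<rfloor> + 1" by linarith
  then show "\<exists>j::int. j \<in> UNIV \<and> p \<in> topspace X \<times> {of_int j..of_int j + 1} \<and> proj p = proj p"
    using p by (intro exI[of _ "\<lfloor>t\<rfloor>"]) auto
qed auto

text \<open>
  The preimage in \<open>X \<times> [0,1]\<close> of the image of \<open>W\<close> is the trace of the union of all translates of \<open>W\<close>, and
  each translation is continuous.
\<close>

lemma open_map_proj: "open_map cylinder torus proj"
  unfolding open_map_def
proof (intro allI impI)
  fix W assume W: "openin cylinder W"
  let ?Q = "prod_topology X (top_of_set {0..1::real})"
  let ?d = "\<lambda>n::int. \<lambda>(x, t). (iter n x, t - of_int n)"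
  have Wsub: "W \<subseteq> topspace X \<times> UNIV" using openin_subset[OF W] by simp
  have "{p \<in> topspace ?Q. (\<lambda>(x, t). torus_point f X x t) p \<in> proj ` W} =
      (\<Union>n. {p \<in> topspace cylinder. ?d n p \<in> W}) \<inter> (UNIV \<times> {0..1})" (is "?L = ?R")
  proof (intro equalityI subsetI)
    fix p assume "p \<in> ?L"
    then obtain x t where p: "p = (x, t)" "x \<in> topspace X" "0 \<le> t" "t \<le> 1"
      "torus_point f X x t \<in> proj ` W" by auto
    then obtain y s where ys: "(y, s) \<in> W" "proj (x, t) = proj (y, s)"
      using proj_eq_torus_point by auto
    then have "y \<in> topspace X" using Wsub by blast
    then obtain n :: int where "s = t - of_int n" "y = iter n x" using ys p proj_eq_iff by metis
    then show "p \<in> ?R" using ys p by auto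
  next
    fix p assume "p \<in> ?R"
    then obtain x t n where p: "p = (x, t)" "x \<in> topspace X" "0 \<le> t" "t \<le> 1"
      "(iter n x, t - of_int n) \<in> W" by auto
    then have "proj (x, t) \<in> proj ` W" using proj_deck by (metis imageI)
    then show "p \<in> ?L" using p proj_eq_torus_point by simp
  qed
  moreover have "openin cylinder (\<Union>n. {p \<in> topspace cylinder. ?d n p \<in> W})"
    using openin_continuous_map_preimage[OF continuous_map_deck W] by (intro openin_Union) auto
  ultimately have "openin ?Q {p \<in> topspace ?Q. (\<lambda>(x, t). torus_point f X x t) p \<in> proj ` W}"
    unfolding prod_topology_subtopology(2) by (auto simp: openin_subtopology)
  moreover have "proj ` W \<subseteq> topspace torus" using Wsub proj_in by auto
  ultimately show "openin torus (proj ` W)"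
    using quotient_map_torus_point[unfolded quotient_map_def, THEN conjunct2, rule_format] by simp
qed

lemma quotient_map_proj: "quotient_map cylinder torus proj"
  by (rule continuous_open_imp_quotient_map[OF continuous_map_proj open_map_proj proj_surj])


section \<open>The mapping torus as a manifold\<close>

abbreviation "section_0 \<equiv> torus_zero_section f X"

lemma proj_eq_imp_eq:
  assumes "x \<in> topspace X" "y \<in> topspace X" "\<bar>s - t\<bar> < 1" "proj (x, s) = proj (y, t)"
  shows "x = y \<and> s = t"
proof -
  obtain n :: int where n: "t = s - of_int n" "y = iter n x" using assms proj_eq_iff by metis
  then have "n = 0" using assms by auto
  then show ?thesis using n by simp
qed

text \<open>
  Representatives can be chosen with \<open>t \<le> s < t + 1\<close>. If \<open>s = t\<close>, the points differ in \<open>X\<close> and are separated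
  there, over intervals of length one on which the projection is injective. Otherwise \<open>s - t\<close> is
  not an integer, and slabs around \<open>s\<close> and \<open>t\<close> that are thin enough have no two times differing by an
  integer.
\<close>

lemma Hausdorff_space_torus:
  assumes "Hausdorff_space X"
  shows "Hausdorff_space torus"
  unfolding Hausdorff_space_def
proof (intro allI impI, elim conjE)
  fix p q assume p: "p \<in> topspace torus" and q: "q \<in> topspace torus" and "p \<noteq> q"
  obtain x s where x: "x \<in> topspace X" "p = proj (x, s)" using torus_cases[OF p] by metis
  obtain y' t' where y': "y' \<in> topspace X" "q = proj (y', t')" using torus_cases[OF q] by metis
  \<comment> \<open>Move the second point along its orbit until its time lies in \<open>(s - 1, s]\<close>.\<close>
  define k where "k = - \<lfloor>s - t'\<rfloor>"
  define y where "y = iter k y'"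
  define t where "t = t' - of_int k"
  have y: "y \<in> topspace X" "q = proj (y, t)" using y' proj_deck by (simp_all add: y_def t_def)
  have t: "t \<le> s" "s < t + 1" unfolding t_def k_def by linarith+
  have opn: "openin torus (proj ` (U \<times> {a<..<b}))" if "openin X U" for U and a b :: real
    using open_map_proj that by (simp add: open_map_def openin_prod_Times_iff)
  have mem: "proj (z, r) \<in> proj ` (U \<times> {r - e<..<r + e})" if "z \<in> U" "e > 0" for z r U and e :: real
    using that by auto
  show "\<exists>U V. openin torus U \<and> openin torus V \<and> p \<in> U \<and> q \<in> V \<and> disjnt U V"
  proof (cases "s = t")
    case True
    then have "x \<noteq> y" using x y \<open>p \<noteq> q\<close> by auto
    then obtain U V where UV: "openin X U" "openin X V" "x \<in> U" "y \<in> V" "disjnt U V"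
      using assms x y unfolding Hausdorff_space_def by metis
    let ?U = "proj ` (U \<times> {s - 1/2<..<s + 1/2})" and ?V = "proj ` (V \<times> {t - 1/2<..<t + 1/2})"
    have sub: "U \<subseteq> topspace X" "V \<subseteq> topspace X" using UV openin_subset by auto
    have "disjnt ?U ?V"
      unfolding disjnt_iff
    proof (intro allI notI, elim conjE imageE SigmaE)
      fix w a b u v c d
      assume *: "w = proj a" "w = proj b" "a = (u, c)" "b = (v, d)" "u \<in> U" "v \<in> V"
        "c \<in> {s - 1/2<..<s + 1/2}" "d \<in> {t - 1/2<..<t + 1/2}"
      then have "\<bar>c - d\<bar> < 1" using True by (simp add: abs_less_iff)
      then have "u = v" using * sub proj_eq_imp_eq[of u v c d] by auto
      then show False using UV * by (auto simp: disjnt_iff)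
    qed
    then show ?thesis
      using UV opn mem[of x U "1/2" s] mem[of y V "1/2" t] x y by (intro exI[of _ ?U] exI[of _ ?V]) auto
  next
    case False
    \<comment> \<open>Times within \<open>e\<close> of \<open>s\<close> and \<open>t\<close> then differ by something strictly between \<open>0\<close> and \<open>1\<close>.\<close>
    define e where "e = min (s - t) (t + 1 - s) / 2"
    have e: "e > 0" "2 * e \<le> s - t" "2 * e \<le> t + 1 - s" using False t by (auto simp: e_def)
    let ?U = "proj ` (topspace X \<times> {s - e<..<s + e})" and ?V = "proj ` (topspace X \<times> {t - e<..<t + e})"
    have "disjnt ?U ?V"
      unfolding disjnt_iff
    proof (intro allI notI, elim conjE imageE SigmaE)
      fix w a b u v c d
      assume *: "w = proj a" "w = proj b" "a = (u, c)" "b = (v, d)" "u \<in> topspace X" "v \<in> topspace X"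
        "c \<in> {s - e<..<s + e}" "d \<in> {t - e<..<t + e}"
      then obtain n :: int where "d = c - of_int n" using proj_eq_iff by metis
      then have "0 < real_of_int n" "real_of_int n < 1" using * e by auto
      then show False by auto
    qed
    then show ?thesis
      using opn mem[of x "topspace X" e s] mem[of y "topspace X" e t] x y e
      by (intro exI[of _ ?U] exI[of _ ?V]) auto
  qed
qed

lemma second_countable_torus:
  assumes "second_countable X"
  shows "second_countable torus"
  by (rule second_countable_open_map_image[OF continuous_map_proj open_map_proj proj_surj
        second_countable_prod_topology[OF assms second_countable_euclideanreal]])

lemma homeomorphic_map_proj:
  assumes U: "openin X U"
  shows "homeomorphic_map (prod_topology (subtopology X U) (top_of_set {s - 1/2<..<s + 1/2}))
    (subtopology torus (proj ` (U \<times> {s - 1/2<..<s + 1/2}))) proj"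
proof -
  let ?J = "{s - 1/2<..<s + 1/2}"
  have sub: "U \<subseteq> topspace X" using U openin_subset by auto
  have opn: "openin cylinder (U \<times> ?J)" using U by (simp add: openin_prod_Times_iff)
  have top: "topspace (subtopology cylinder (U \<times> ?J)) = U \<times> ?J"
    using sub by (auto simp: topspace_subtopology)
  have "embedding_map (subtopology cylinder (U \<times> ?J)) torus proj"
  proof (rule injective_open_imp_embedding_map)
    show "continuous_map (subtopology cylinder (U \<times> ?J)) torus proj"
      by (rule continuous_map_from_subtopology[OF continuous_map_proj])
    show "open_map (subtopology cylinder (U \<times> ?J)) torus proj"
      by (rule open_map_from_subtopology[OF open_map_proj opn])
    show "inj_on proj (topspace (subtopology cylinder (U \<times> ?J)))"
      unfolding top
    proof (rule inj_onI)
      fix a b assume ab: "a \<in> U \<times> ?J" "b \<in> U \<times> ?J" "proj a = proj b"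
      then have "\<bar>snd a - snd b\<bar> < 1" by (auto simp: abs_less_iff)
      then show "a = b"
        using ab proj_eq_imp_eq[of "fst a" "fst b" "snd a" "snd b"] subsetD[OF sub]
        by (auto simp: prod_eq_iff mem_Times_iff)
    qed
  qed
  then show ?thesis unfolding embedding_map_def top by (simp add: subtopology_Times)
qed

text \<open>
  A parametrization of \<open>X\<close> by \<open>\<real>\<^sup>m\<close> times one of the interval of length one around \<open>s\<close> by the line, followed by the
  projection. The statement about signs says that the last coordinate of the chart
  measures on which side of \<open>s\<close> the time lies; it is what later makes the section a hyperplane.
\<close>

lemma torus_chart:
  assumes X: "manifold_of_dim m X" and x: "x \<in> topspace X"
  obtains U W \<phi> where "openin X U" "x \<in> U" "W = proj ` (U \<times> {s - 1/2<..<s + 1/2})" "openin torus W"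
    "homeomorphic_map (subtopology torus W) (Euclidean_space (Suc m)) \<phi>"
    "\<And>y t. y \<in> U \<Longrightarrow> t \<in> {s - 1/2<..<s + 1/2} \<Longrightarrow> sgn (\<phi> (proj (y, t)) m) = sgn (t - s)"
proof -
  obtain U g where U: "openin X U" "x \<in> U"
    and g: "homeomorphic_map (Euclidean_space m) (subtopology X U) g"
    using manifold_of_dim_imp_Euclidean_parametrization[OF X x] by metis
  define J where "J = {s - 1/2<..<s + 1/2}"
  define W where "W = proj ` (U \<times> J)"
  define \<theta> where "\<theta> = (\<lambda>u::real. s + u / (2 * (1 + \<bar>u\<bar>)))"
  have sub: "U \<subseteq> topspace X" using U openin_subset by auto
  have \<theta>: "homeomorphic_map euclideanreal (top_of_set J) \<theta>"
    unfolding \<theta>_def J_def by (rule homeomorphic_map_euclideanreal_interval)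
  have sgn_\<theta>: "sgn (\<theta> u - s) = sgn u" for u
    by (auto simp: \<theta>_def sgn_if divide_less_0_iff zero_less_divide_iff zero_less_mult_iff mult_less_0_iff)
  have prod: "homeomorphic_map (prod_topology (Euclidean_space m) euclideanreal)
      (prod_topology (subtopology X U) (top_of_set J)) (\<lambda>(v, u). (g v, \<theta> u))"
  proof -
    obtain g' \<theta>' where "homeomorphic_maps (Euclidean_space m) (subtopology X U) g g'"
      "homeomorphic_maps euclideanreal (top_of_set J) \<theta> \<theta>'"
      using g \<theta> homeomorphic_map_maps by metis
    then have "homeomorphic_maps (prod_topology (Euclidean_space m) euclideanreal)
      (prod_topology (subtopology X U) (top_of_set J)) (\<lambda>(v, u). (g v, \<theta> u)) (\<lambda>(v, u). (g' v, \<theta>' u))"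
      by (simp add: homeomorphic_maps_prod)
    then show ?thesis by (rule homeomorphic_maps_imp_map)
  qed
  define G where "G = proj \<circ> ((\<lambda>(v, u). (g v, \<theta> u)) \<circ> (\<lambda>v. (v(m := 0), v m)))"
  have emb: "homeomorphic_map (prod_topology (subtopology X U) (top_of_set J)) (subtopology torus W) proj"
    unfolding W_def J_def by (rule homeomorphic_map_proj[OF U(1)])
  have G: "homeomorphic_map (Euclidean_space (Suc m)) (subtopology torus W) G"
    unfolding G_def
    by (rule homeomorphic_map_compose[OF homeomorphic_map_compose[OF
          homeomorphic_map_Euclidean_space_Suc prod] emb])
  obtain \<phi> where \<phi>: "homeomorphic_maps (Euclidean_space (Suc m)) (subtopology torus W) G \<phi>"
    using G homeomorphic_map_maps by metis
  have W: "openin torus W"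
    using open_map_proj U by (simp add: W_def J_def open_map_def openin_prod_Times_iff)
  have "sgn (\<phi> (proj (y, t)) m) = sgn (t - s)" if y: "y \<in> U" "t \<in> J" for y t
  proof -
    have "proj (y, t) \<in> topspace (subtopology torus W)"
      using y sub proj_in by (auto simp: W_def)
    then obtain v where v: "v \<in> topspace (Euclidean_space (Suc m))" "v = \<phi> (proj (y, t))" "G v = proj (y, t)"
      using \<phi> by (auto simp: homeomorphic_maps_def continuous_map_def Pi_iff)
    have "(v(m := 0), v m) \<in> topspace (prod_topology (Euclidean_space m) euclideanreal)"
      using v(1) by (auto simp: topspace_Euclidean_space)
    from imageI[OF this, of "\<lambda>(v, u). (g v, \<theta> u)"]
    have "(g (v(m := 0)), \<theta> (v m)) \<in> topspace (prod_topology (subtopology X U) (top_of_set J))"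
      by (simp only: homeomorphic_imp_surjective_map[OF prod] prod.case)
    moreover have "(y, t) \<in> topspace (prod_topology (subtopology X U) (top_of_set J))"
      using y sub by auto
    moreover have "proj (g (v(m := 0)), \<theta> (v m)) = proj (y, t)" using v(3) by (simp add: G_def)
    ultimately have "\<theta> (v m) = t"
      using homeomorphic_imp_injective_map[OF emb] by (metis inj_onD prod.inject)
    then show ?thesis using sgn_\<theta> v(2) by metis
  qed
  moreover have "homeomorphic_map (subtopology torus W) (Euclidean_space (Suc m)) \<phi>"
    using \<phi> homeomorphic_maps_sym homeomorphic_maps_imp_map by metis
  ultimately show thesis using that[OF U _ W] unfolding W_def J_def by blast
qed

lemma manifold_of_dim_torus:
  assumes X: "manifold_of_dim m X"
  shows "manifold_of_dim (Suc m) torus"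
  unfolding manifold_of_dim_def
proof (intro conjI ballI)
  show "Hausdorff_space torus" "second_countable torus"
    using X Hausdorff_space_torus second_countable_torus by (auto simp: manifold_of_dim_def)
  fix p assume "p \<in> topspace torus"
  then obtain x s where x: "x \<in> topspace X" "p = proj (x, s)" using torus_cases by metis
  obtain U W \<phi> where U: "x \<in> U" "W = proj ` (U \<times> {s - 1/2<..<s + 1/2})" "openin torus W"
    and \<phi>: "homeomorphic_map (subtopology torus W) (Euclidean_space (Suc m)) \<phi>"
    using torus_chart[OF X x(1), of s] by metis
  have "p \<in> W" using x U by auto
  moreover have "subtopology torus W homeomorphic_space
      subtopology (Euclidean_space (Suc m)) (topspace (Euclidean_space (Suc m)))"
    using \<phi> homeomorphic_space by (metis subtopology_topspace)
  ultimately show "\<exists>U W. openin torus U \<and> p \<in> U \<and> openin (Euclidean_space (Suc m)) W \<and>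
      subtopology torus U homeomorphic_space subtopology (Euclidean_space (Suc m)) W"
    using U by (intro exI[of _ W] exI[of _ "topspace (Euclidean_space (Suc m))"]) auto
qed


section \<open>The suspension flow\<close>

text \<open>
  Seen from the cylinder the suspension flow is translation; the floor in its definition only
  returns to the representative in \<open>[0,1)\<close>.
\<close>

lemma suspension_flow_proj:
  assumes x: "x \<in> topspace X"
  shows "suspension_flow f X (proj (x, t), s) = proj (x, t + s)"
proof -
  define r where "r = t - of_int \<lfloor>t\<rfloor>"
  define n where "n = \<lfloor>s + r\<rfloor>"
  have fl: "\<lfloor>s + t\<rfloor> = n + \<lfloor>t\<rfloor>" unfolding n_def r_def by linarith
  have "suspension_flow f X (torus_point f X (iter \<lfloor>t\<rfloor> x) r, s) =
      torus_point f X (iter n (iter \<lfloor>t\<rfloor> x)) (s + r - of_int n)"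
    by (rule suspension_flow_point[OF maps])
      (use x in \<open>auto simp: r_def n_def floor_correct\<close>, linarith+)
  then show ?thesis
    using iter_add[OF x, of n "\<lfloor>t\<rfloor>"] by (simp add: torus_proj_def r_def fl algebra_simps)
qed

text \<open>
  The product of the projection with the line is again a quotient map because the line is
  locally compact, so continuity may be tested on \<open>X \<times> \<real> \<times> \<real>\<close>, where the flow is addition.
\<close>

lemma continuous_map_suspension_flow:
  "continuous_map (prod_topology torus euclideanreal) torus (suspension_flow f X)"
proof (rule continuous_compose_quotient_map)
  show "quotient_map (prod_topology cylinder euclideanreal) (prod_topology torus euclideanreal)
      (\<lambda>(p, s). (proj p, s))"
    by (rule quotient_map_prod_left[OF _ _ quotient_map_proj])
      (auto simp: locally_compact_space_euclidean)
  have "continuous_map (prod_topology cylinder euclideanreal) X (fst \<circ> fst)"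
    by (rule continuous_map_compose[OF continuous_map_fst continuous_map_fst])
  moreover have "continuous_map (prod_topology cylinder euclideanreal) euclideanreal (\<lambda>p. (snd \<circ> fst) p + snd p)"
    by (rule continuous_map_add[OF continuous_map_compose[OF continuous_map_fst continuous_map_snd] continuous_map_snd])
  ultimately have "continuous_map (prod_topology cylinder euclideanreal) cylinder
      (\<lambda>p. ((fst \<circ> fst) p, (snd \<circ> fst) p + snd p))"
    by (rule continuous_map_pairedI)
  from continuous_map_compose[OF this continuous_map_proj]
  show "continuous_map (prod_topology cylinder euclideanreal) torus
      (suspension_flow f X \<circ> (\<lambda>(p, s). (proj p, s)))"
    by (rule continuous_map_eq) (auto simp: suspension_flow_proj)
qed

lemma flow_suspension_flow:
  assumes "manifold X"
  shows "flow (suspension_flow f X) torus"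
  unfolding flow_def
proof (intro conjI ballI allI)
  show "manifold torus" using assms manifold_of_dim_torus unfolding manifold_def by blast
  show "suspension_flow f X \<in> extensional (topspace torus \<times> UNIV)"
    by (simp add: suspension_flow_def)
  show "continuous_map (prod_topology torus euclideanreal) torus (suspension_flow f X)"
    by (rule continuous_map_suspension_flow)
next
  fix p assume "p \<in> topspace torus"
  then show "suspension_flow f X (p, 0) = p"
    by (rule torus_cases) (simp add: suspension_flow_proj)
next
  fix p t s assume "p \<in> topspace torus"
  then show "suspension_flow f X (suspension_flow f X (p, t), s) = suspension_flow f X (p, t + s)"
    by (rule torus_cases) (simp add: suspension_flow_proj add.assoc)
qed


section \<open>The zero section is a global Poincare section\<close>

lemma section_0_eq: "section_0 = (\<lambda>x. proj (x, 0)) ` topspace X"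
  using proj_eq_torus_point[of _ 0] by (auto simp: torus_zero_section_def image_iff)

lemma proj_in_section_0_iff:
  assumes "x \<in> topspace X"
  shows "proj (x, t) \<in> section_0 \<longleftrightarrow> t \<in> \<int>"
proof
  assume "proj (x, t) \<in> section_0"
  then obtain y where "y \<in> topspace X" "proj (x, t) = proj (y, 0)" by (auto simp: section_0_eq)
  then obtain n :: int where "0 = t - of_int n" using assms proj_eq_iff by metis
  then have "t = of_int n" by simp
  then show "t \<in> \<int>" by simp
next
  assume "t \<in> \<int>"
  then obtain n :: int where "t = of_int n" by (auto elim: Ints_cases)
  then have "proj (x, t) = proj (iter n x, 0)" using proj_deck[OF assms, of n t] by simp
  then show "proj (x, t) \<in> section_0" using assms by (auto simp: section_0_eq)
qed

text \<open>
  The chart around time \<open>0\<close>: in the interval \<open>(-1/2, 1/2)\<close> the only integer is \<open>0\<close>, so the section is the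
  zero set of the last coordinate, whose sign along the orbit of \<open>[x, 0]\<close> is that of the time.
\<close>

lemma section_chart:
  assumes X: "manifold_of_dim m X" and x: "x \<in> topspace X"
  obtains W \<phi> where "openin torus W"
    "homeomorphic_map (subtopology torus W) (Euclidean_space (Suc m)) \<phi>"
    "\<And>w. w \<in> W \<Longrightarrow> w \<in> section_0 \<longleftrightarrow> \<phi> w m = 0"
    "\<And>t. \<bar>t\<bar> < 1/2 \<Longrightarrow> proj (x, t) \<in> W"
    "\<And>t. \<bar>t\<bar> < 1/2 \<Longrightarrow> sgn (\<phi> (proj (x, t)) m) = sgn t"
proof -
  obtain U W \<phi> where U: "openin X U" "x \<in> U" and W: "W = proj ` (U \<times> {0 - 1/2<..<0 + 1/2})" "openin torus W"
    and \<phi>: "homeomorphic_map (subtopology torus W) (Euclidean_space (Suc m)) \<phi>"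
    and sgn: "\<And>y t. y \<in> U \<Longrightarrow> t \<in> {0 - 1/2<..<0 + 1/2} \<Longrightarrow> sgn (\<phi> (proj (y, t)) m) = sgn (t - 0)"
    using torus_chart[OF X x, of 0] by metis
  show thesis
  proof (rule that[OF W(2) \<phi>])
    fix w assume "w \<in> W"
    then obtain y t where y: "y \<in> U" "- 1/2 < t" "t < 1/2" "w = proj (y, t)" using W by auto
    have "w \<in> section_0 \<longleftrightarrow> t \<in> \<int>"
      using y proj_in_section_0_iff[OF subsetD[OF openin_subset[OF U(1)] y(1)]] by simp
    also have "\<dots> \<longleftrightarrow> t = 0" using y by (auto elim!: Ints_cases)
    also have "\<dots> \<longleftrightarrow> \<phi> w m = 0" using sgn[of y t] y by (auto simp: sgn_if split: if_splits)
    finally show "w \<in> section_0 \<longleftrightarrow> \<phi> w m = 0" .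
  next
    fix t :: real assume "\<bar>t\<bar> < 1/2"
    then have t: "t \<in> {0 - 1/2<..<0 + 1/2}" by auto
    then show "proj (x, t) \<in> W" unfolding W(1) by (intro imageI SigmaI U(2))
    show "sgn (\<phi> (proj (x, t)) m) = sgn t" using sgn[OF U(2) t] by simp
  qed
qed

lemma section_0_subset: "section_0 \<subseteq> topspace torus"
  using proj_in by (auto simp: section_0_eq)

lemma image_section_chart:
  assumes \<phi>: "homeomorphic_map (subtopology torus W) (Euclidean_space (Suc m)) \<phi>"
    and W: "openin torus W" and S: "\<And>w. w \<in> W \<Longrightarrow> w \<in> section_0 \<longleftrightarrow> \<phi> w m = 0"
  shows "\<phi> ` (W \<inter> section_0) = topspace (Euclidean_space m)"
proof -
  have "\<phi> ` W = topspace (Euclidean_space (Suc m))"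
    using homeomorphic_imp_surjective_map[OF \<phi>] openin_subset[OF W]
    by (simp add: Int_absorb1)
  then have "\<phi> ` (W \<inter> section_0) = topspace (Euclidean_space (Suc m)) \<inter> {v. v m = 0}"
    using S by (rule image_Int_Collect[where P = "\<lambda>v. v m = 0"])
  then show ?thesis
    using topspace_subtopology[of "Euclidean_space (Suc m)" "{v. v m = 0}"]
    by (simp add: subtopology_Euclidean_space_hyperplane)
qed

text \<open>
  Section charts restrict to charts of the section with values in the hyperplane.
\<close>

lemma manifold_of_dim_section_0:
  assumes X: "manifold_of_dim m X"
  shows "manifold_of_dim m (subtopology torus section_0)"
  unfolding manifold_of_dim_def
proof (intro conjI ballI)
  show "Hausdorff_space (subtopology torus section_0)" "second_countable (subtopology torus section_0)"
    using manifold_of_dim_torus[OF X] Hausdorff_space_subtopology second_countable_subtopology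
    by (auto simp: manifold_of_dim_def)
  fix p assume "p \<in> topspace (subtopology torus section_0)"
  then obtain x where x: "x \<in> topspace X" "p = proj (x, 0)" by (auto simp: section_0_eq)
  obtain W \<phi> where W: "openin torus W"
    and \<phi>: "homeomorphic_map (subtopology torus W) (Euclidean_space (Suc m)) \<phi>"
    and S: "\<And>w. w \<in> W \<Longrightarrow> w \<in> section_0 \<longleftrightarrow> \<phi> w m = 0"
    and pW: "\<And>t. \<bar>t\<bar> < 1/2 \<Longrightarrow> proj (x, t) \<in> W"
    using section_chart[OF X x(1)] by metis
  let ?V = "section_0 \<inter> W"
  have "homeomorphic_map (subtopology (subtopology torus W) section_0)
      (subtopology (Euclidean_space (Suc m)) {v. v m = 0}) \<phi>"
    by (rule homeomorphic_map_subtopologies_alt[OF \<phi>]) (use S in auto)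
  then have "subtopology (subtopology torus section_0) ?V homeomorphic_space
      subtopology (Euclidean_space m) (topspace (Euclidean_space m))"
    using homeomorphic_space
    by (auto simp: subtopology_Euclidean_space_hyperplane subtopology_subtopology Int_ac)
  moreover have "openin (subtopology torus section_0) ?V"
    using W openin_subtopology_Int2 by blast
  moreover have "p \<in> ?V" using pW[of 0] x section_0_eq by auto
  ultimately show "\<exists>U W. openin (subtopology torus section_0) U \<and> p \<in> U \<and> openin (Euclidean_space m) W \<and>
      subtopology (subtopology torus section_0) U homeomorphic_space subtopology (Euclidean_space m) W"
    by (intro exI[of _ ?V] exI[of _ "topspace (Euclidean_space m)"]) auto
qed

lemma locally_flat_section_0:
  assumes X: "manifold_of_dim m X"
  shows "locally_flat m (Suc m) torus section_0"
  unfolding locally_flat_def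
proof
  fix p assume "p \<in> section_0"
  then obtain x where x: "x \<in> topspace X" "p = proj (x, 0)" by (auto simp: section_0_eq)
  obtain W \<phi> where W: "openin torus W"
    and \<phi>: "homeomorphic_map (subtopology torus W) (Euclidean_space (Suc m)) \<phi>"
    and S: "\<And>w. w \<in> W \<Longrightarrow> w \<in> section_0 \<longleftrightarrow> \<phi> w m = 0"
    and pW: "\<And>t. \<bar>t\<bar> < 1/2 \<Longrightarrow> proj (x, t) \<in> W"
    using section_chart[OF X x(1)] by metis
  have "p \<in> W" using pW[of 0] x by simp
  then show "\<exists>U \<phi>. openin torus U \<and> p \<in> U \<and>
      homeomorphic_map (subtopology torus U) (Euclidean_space (Suc m)) \<phi> \<and>
      \<phi> ` (U \<inter> section_0) = topspace (Euclidean_space m)"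
    using image_section_chart[OF \<phi> W S] W \<phi> by blast
qed

lemma continuous_map_orbit:
  assumes "x \<in> topspace X"
  shows "continuous_map euclideanreal torus (\<lambda>t. proj (x, t))"
proof -
  have "continuous_map euclideanreal cylinder (\<lambda>t. (x, t))"
    using assms by (intro continuous_map_pairedI) auto
  from continuous_map_compose[OF this continuous_map_proj] show ?thesis by (simp add: o_def)
qed

lemma orbit_in_component:
  assumes x: "x \<in> topspace X" and I: "is_interval I" "\<tau> \<in> I"
    and sub: "(\<lambda>t. proj (x, t)) ` I \<subseteq> W - section_0"
  shows "(\<lambda>t. proj (x, t)) ` I \<subseteq>
    connected_component_of_set (subtopology torus (W - section_0)) (proj (x, \<tau>))"
proof -
  have "connectedin torus ((\<lambda>t. proj (x, t)) ` I)"
    using connectedin_continuous_map_image[OF continuous_map_orbit[OF x]] I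
    by (simp add: is_interval_connected_1)
  then have "connectedin (subtopology torus (W - section_0)) ((\<lambda>t. proj (x, t)) ` I)"
    using sub by (simp add: connectedin_subtopology)
  then show ?thesis
    by (rule connected_component_of_maximal) (use I in auto)
qed

text \<open>
  Intermediate value theorem: the last coordinate is continuous, vanishes exactly on the section,
  and so cannot change sign on a connected set avoiding the section.
\<close>

lemma section_0_separates:
  assumes \<phi>: "homeomorphic_map (subtopology torus W) (Euclidean_space (Suc m)) \<phi>"
    and S: "\<And>w. w \<in> W \<Longrightarrow> w \<in> section_0 \<longleftrightarrow> \<phi> w m = 0"
    and K: "connectedin (subtopology torus (W - section_0)) K"
    and pq: "p \<in> K" "\<phi> p m < 0" "q \<in> K" "\<phi> q m > 0"
  shows False
proof -
  have KW: "connectedin torus K" "K \<subseteq> W - section_0" using K by (auto simp: connectedin_subtopology)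
  then have "connectedin (subtopology torus W) K" by (auto simp: connectedin_subtopology)
  moreover have "continuous_map (subtopology torus W) euclideanreal ((\<lambda>v. v m) \<circ> \<phi>)"
    by (rule continuous_map_compose[OF homeomorphic_imp_continuous_map[OF \<phi>]
          continuous_map_Euclidean_space_coordinate])
  ultimately have "connectedin euclideanreal (((\<lambda>v. v m) \<circ> \<phi>) ` K)"
    using connectedin_continuous_map_image by blast
  then have "is_interval ((\<lambda>w. \<phi> w m) ` K)"
    by (simp add: is_interval_connected_1 o_def)
  then have "0 \<in> (\<lambda>w. \<phi> w m) ` K"
    using pq unfolding is_interval_1 by (meson image_eqI less_imp_le)
  then show False using KW S by auto
qed

text \<open>
  The flow has unit speed in the second coordinate and the charts cover the times in \<open>(-1/2, 1/2)\<close>, so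
  the constant functions \<open>1/4\<close> and \<open>-1/4\<close> serve as \<open>\<delta>\<^sub>+\<close> and \<open>\<delta>\<^sub>-\<close> for all points of the section, and
  \<open>1/8\<close> as the locally uniform bound.
\<close>

lemma topologically_transversal_section_0:
  assumes "manifold X"
  shows "topologically_transversal (suspension_flow f X) torus section_0"
proof -
  obtain m where X: "manifold_of_dim m X" using assms by (auto simp: manifold_def)
  let ?E = "Euclidean_space (Suc m)" and ?\<Phi> = "suspension_flow f X"
  define \<sigma> where "\<sigma> = (\<lambda>v::nat \<Rightarrow> real. \<lambda>i. v i / (1 + L2_set v {..<Suc m}))"
  have \<sigma>: "homeomorphic_map ?E (subtopology ?E (unit_ball (Suc m))) \<sigma>"
    unfolding \<sigma>_def by (rule homeomorphic_map_Euclidean_space_unit_ball)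
  have \<sigma>0: "\<sigma> v m = 0 \<longleftrightarrow> v m = 0" for v
  proof -
    have "1 + L2_set v {..<Suc m} \<noteq> 0" using L2_set_nonneg[of v "{..<Suc m}"] by linarith
    then show ?thesis by (simp add: \<sigma>_def)
  qed
  have crossing: "\<exists>U \<phi>. openin torus U \<and> p \<in> U \<and>
      homeomorphic_map (subtopology torus U) (subtopology ?E (unit_ball (Suc m))) \<phi> \<and>
      \<phi> ` (U \<inter> section_0) = unit_ball (Suc m) \<inter> {v. v m = 0} \<and>
      (1/4 :: real) > 0 \<and> (- 1/4 :: real) < 0 \<and>
      (\<exists>K L. K \<in> connected_components_of (subtopology torus (U - section_0)) \<and>
        L \<in> connected_components_of (subtopology torus (U - section_0)) \<and> K \<noteq> L \<and>
        (\<lambda>t. ?\<Phi> (p, t)) ` {- 1/4..<0} \<subseteq> K \<and> (\<lambda>t. ?\<Phi> (p, t)) ` {0<..1/4} \<subseteq> L) \<and>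
      (\<lambda>t. ?\<Phi> (p, t)) ` {- 1/4..1/4} \<inter> section_0 = {p} \<and>
      (\<exists>V \<delta>. openin torus V \<and> p \<in> V \<and> V \<subseteq> U \<and> \<delta> > 0 \<and>
        (\<forall>y\<in>V \<inter> section_0. (1/4 :: real) > \<delta> \<and> - 1/4 < - \<delta>))" if p: "p \<in> section_0" for p
  proof -
    obtain x where x: "x \<in> topspace X" "p = proj (x, 0)" using p by (auto simp: section_0_eq)
    obtain W \<phi> where W: "openin torus W"
      and \<phi>: "homeomorphic_map (subtopology torus W) ?E \<phi>"
      and S: "\<And>w. w \<in> W \<Longrightarrow> w \<in> section_0 \<longleftrightarrow> \<phi> w m = 0"
      and pW: "\<And>t. \<bar>t\<bar> < 1/2 \<Longrightarrow> proj (x, t) \<in> W"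
      and sgn: "\<And>t. \<bar>t\<bar> < 1/2 \<Longrightarrow> sgn (\<phi> (proj (x, t)) m) = sgn t"
      using section_chart[OF X x(1)] by metis
    have \<sigma>\<phi>: "homeomorphic_map (subtopology torus W) (subtopology ?E (unit_ball (Suc m))) (\<sigma> \<circ> \<phi>)"
      by (rule homeomorphic_map_compose[OF \<phi> \<sigma>])
    have "(\<sigma> \<circ> \<phi>) ` W = unit_ball (Suc m)"
      using homeomorphic_imp_surjective_map[OF \<sigma>\<phi>] openin_subset[OF W] openin_subset[OF openin_unit_ball]
      by (simp add: image_comp Int_absorb1)
    then have flat: "(\<sigma> \<circ> \<phi>) ` (W \<inter> section_0) = unit_ball (Suc m) \<inter> {v. v m = 0}"
      by (rule image_Int_Collect[where P = "\<lambda>v. v m = 0"]) (use S \<sigma>0 in simp)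
    have onS: "proj (x, t) \<in> section_0 \<longleftrightarrow> t = 0" if "\<bar>t\<bar> < 1/2" for t
      using S[OF pW[OF that]] sgn[OF that] by (auto simp: sgn_if split: if_splits)
    let ?T = "subtopology torus (W - section_0)"
    define K where "K = connected_component_of_set ?T (proj (x, - 1/4))"
    define L where "L = connected_component_of_set ?T (proj (x, 1/4))"
    have neg: "(\<lambda>t. proj (x, t)) ` {- 1/4..<0} \<subseteq> K"
      unfolding K_def
      by (rule orbit_in_component[OF x(1)]) (use pW onS in \<open>auto simp: is_interval_1\<close>)
    have pos: "(\<lambda>t. proj (x, t)) ` {0<..1/4} \<subseteq> L"
      unfolding L_def
      by (rule orbit_in_component[OF x(1)]) (use pW onS in \<open>auto simp: is_interval_1\<close>)
    have top: "proj (x, t) \<in> topspace ?T" if "\<bar>t\<bar> < 1/2" "t \<noteq> 0" for t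
      using that pW onS proj_in x by simp
    have "K \<in> connected_components_of ?T" "L \<in> connected_components_of ?T"
      unfolding K_def L_def connected_components_of_def using top[of "- 1/4"] top[of "1/4"] by auto
    moreover have "K \<noteq> L"
    proof
      assume "K = L"
      moreover have "proj (x, - 1/4) \<in> K" "proj (x, 1/4) \<in> L" using neg pos by auto
      moreover have "\<phi> (proj (x, - 1/4)) m < 0" "\<phi> (proj (x, 1/4)) m > 0"
        using sgn[of "- 1/4"] sgn[of "1/4"] by (auto simp: sgn_if split: if_splits)
      moreover have "connectedin ?T K"
        unfolding K_def by (rule connectedin_connected_component_of)
      ultimately show False using section_0_separates[OF \<phi> S] by metis
    qed
    moreover have "(\<lambda>t. proj (x, t)) ` {- 1/4..1/4} \<inter> section_0 = {p}"
    proof (intro equalityI subsetI)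
      fix w assume "w \<in> (\<lambda>t. proj (x, t)) ` {- 1/4..1/4} \<inter> section_0"
      then obtain t where "w = proj (x, t)" "\<bar>t\<bar> < 1/2" "proj (x, t) \<in> section_0" by (auto simp: abs_less_iff)
      then show "w \<in> {p}" using onS x by auto
    qed (use p x in auto)
    moreover have "p \<in> W" using pW[of 0] x by simp
    moreover have orbit: "?\<Phi> (p, t) = proj (x, t)" for t
      using suspension_flow_proj[OF x(1), of 0 t] x(2) by simp
    ultimately show ?thesis
      unfolding orbit using W \<sigma>\<phi> flat neg pos
      by (intro exI[of _ W] exI[of _ "\<sigma> \<circ> \<phi>"] exI[of _ K] exI[of _ L] exI[of _ "1/8"] conjI)
        (assumption | simp)+
  qed
  have compact: "compactin (subtopology torus section_0) ((\<lambda>t. ?\<Phi> (q, t)) ` {a..b} \<inter> section_0)"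
    if q: "q \<in> topspace torus" for q a b
  proof (rule finite_imp_compactin)
    obtain x s where x: "x \<in> topspace X" "q = proj (x, s)" using torus_cases[OF q] by metis
    have "(\<lambda>t. ?\<Phi> (q, t)) ` {a..b} \<inter> section_0 \<subseteq>
        (\<lambda>t. proj (x, t)) ` {t \<in> \<int>. s + a \<le> t \<and> t \<le> s + b}"
      using x by (auto simp: suspension_flow_proj proj_in_section_0_iff)
    then show "finite ((\<lambda>t. ?\<Phi> (q, t)) ` {a..b} \<inter> section_0)"
      by (rule finite_subset) (intro finite_imageI finite_int_segment)
    show "(\<lambda>t. ?\<Phi> (q, t)) ` {a..b} \<inter> section_0 \<subseteq> topspace (subtopology torus section_0)"
      using section_0_subset by auto
  qed
  show ?thesis
    unfolding topologically_transversal_def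
  proof (intro conjI exI[of _ "Suc m"], goal_cases)
    case 1
    show ?case by (rule section_0_subset)
  next
    case 3
    show ?case by (rule manifold_of_dim_torus[OF X])
  next
    case 4
    show ?case using manifold_of_dim_section_0[OF X] by simp
  next
    case 5
    show ?case using locally_flat_section_0[OF X] by simp
  next
    case 6
    show ?case
      unfolding diff_Suc_1
      by (intro exI[of _ "\<lambda>_. 1/4"] exI[of _ "\<lambda>_. - 1/4"] ballI crossing)
  next
    case 7
    show ?case using compact by blast
  qed simp
qed

lemma global_poincare_section_section_0:
  assumes "manifold X"
  shows "global_poincare_section (suspension_flow f X) torus section_0"
  unfolding global_poincare_section_def
proof (intro conjI ballI topologically_transversal_section_0[OF assms])
  fix p assume "p \<in> topspace torus"
  then obtain x s where x: "x \<in> topspace X" "p = proj (x, s)" using torus_cases by metis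
  have hit: "suspension_flow f X (p, of_int n - s) \<in> section_0" for n :: int
    using x by (simp add: suspension_flow_proj proj_in_section_0_iff)
  have "of_int (\<lfloor>s\<rfloor> + 1) - s > 0" "of_int (\<lceil>s\<rceil> - 1) - s < 0" by linarith+
  then show "\<exists>t>0. suspension_flow f X (p, t) \<in> section_0" "\<exists>t<0. suspension_flow f X (p, t) \<in> section_0"
    using hit by blast+
qed

end


section \<open>Induced maps of mapping tori\<close>

locale equivariant_map =
  source: self_homeomorphism f X + target: self_homeomorphism g Y
  for f :: "'a \<Rightarrow> 'a" and X and g :: "'b \<Rightarrow> 'b" and Y +
  fixes h :: "'a \<Rightarrow> 'b"
  assumes cont: "continuous_map X Y h"
    and equivariant: "\<And>x. x \<in> topspace X \<Longrightarrow> h (f x) = g (h x)"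

text \<open>
  The map \<open>[x, t] \<mapsto> [h x, t]\<close>, computed from an arbitrary preimage of the point in the cylinder;
  for equivariant \<open>h\<close> the choice is immaterial by \<open>torus_map_proj\<close> below.
\<close>

definition torus_map ::
  "('a \<Rightarrow> 'a) \<Rightarrow> 'a topology \<Rightarrow> ('b \<Rightarrow> 'b) \<Rightarrow> 'b topology \<Rightarrow> ('a \<Rightarrow> 'b) \<Rightarrow> ('a \<times> real) set \<Rightarrow> ('b \<times> real) set"
  where "torus_map f X g Y h = (\<lambda>p\<in>topspace (mapping_torus f X).
    torus_proj g Y (map_prod h id (inv_into (topspace X \<times> UNIV) (torus_proj f X) p)))"

context equivariant_map
begin

lemma h_in [simp, intro]: "x \<in> topspace X \<Longrightarrow> h x \<in> topspace Y"
  using cont by (auto simp: continuous_map_def)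

lemma iter_equivariant:
  assumes x: "x \<in> topspace X"
  shows "h (source.iter n x) = target.iter n (h x)"
proof (induction n rule: int_induct[where k = 0])
  case (step1 i)
  then show ?case using x equivariant by (simp add: source.iter_succ target.iter_succ)
next
  case (step2 i)
  have "g (h (source.iter (i - 1) x)) = g (target.iter (i - 1) (h x))"
    using step2 x equivariant[of "source.iter (i - 1) x"] source.iter_succ[of x "i - 1"]
      target.iter_succ[of "h x" "i - 1"] by simp
  then show ?case
    using x inj_onD[OF bij_betw_imp_inj_on[OF target.bij]] by blast
qed simp

text \<open>
  Two preimages of a point differ by an iterate of \<open>f\<close>, which \<open>h\<close> turns into the same iterate of \<open>g\<close>.
\<close>

lemma torus_map_proj:
  assumes x: "x \<in> topspace X"
  shows "torus_map f X g Y h (source.proj (x, t)) = target.proj (h x, t)"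
proof -
  obtain y s where ys: "inv_into (topspace X \<times> UNIV) source.proj (source.proj (x, t)) = (y, s)"
    by fastforce
  have "source.proj (x, t) \<in> source.proj ` (topspace X \<times> UNIV)" using x by blast
  from inv_into_into[OF this] f_inv_into_f[OF this]
  have y: "y \<in> topspace X" "source.proj (x, t) = source.proj (y, s)" unfolding ys by auto
  then obtain n :: int where n: "s = t - of_int n" "y = source.iter n x"
    using source.proj_eq_iff[OF x] by metis
  have "torus_map f X g Y h (source.proj (x, t)) = target.proj (h y, s)"
    using source.proj_in[OF x] by (simp add: torus_map_def ys)
  also have "\<dots> = target.proj (h x, t)"
    using n x by (simp add: iter_equivariant target.proj_deck)
  finally show ?thesis .
qed

lemma torus_map_point:
  assumes "x \<in> topspace X" "0 \<le> t" "t < 1"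
  shows "torus_map f X g Y h (torus_point f X x t) = torus_point g Y (h x) t"
  using torus_map_proj[OF assms(1), of t] assms
  by (simp add: source.proj_eq_torus_point target.proj_eq_torus_point)

lemma continuous_map_torus_map: "continuous_map source.torus target.torus (torus_map f X g Y h)"
proof (rule continuous_compose_quotient_map[OF source.quotient_map_proj])
  have "continuous_map source.cylinder Y (h \<circ> fst)"
    by (rule continuous_map_compose[OF continuous_map_fst cont])
  then have "continuous_map source.cylinder target.cylinder (\<lambda>p. ((h \<circ> fst) p, snd p))"
    by (rule continuous_map_pairedI[OF _ continuous_map_snd])
  from continuous_map_compose[OF this target.continuous_map_proj]
  show "continuous_map source.cylinder target.torus (torus_map f X g Y h \<circ> source.proj)"
    by (rule continuous_map_eq) (auto simp: torus_map_proj)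
qed

lemma flow_morphism_torus_map:
  "flow_morphism (suspension_flow f X) source.torus (suspension_flow g Y) target.torus (torus_map f X g Y h)"
  unfolding flow_morphism_def
proof (intro conjI ballI allI continuous_map_torus_map)
  show "torus_map f X g Y h \<in> extensional (topspace source.torus)" by (simp add: torus_map_def)
  fix p t assume "p \<in> topspace source.torus"
  then show "torus_map f X g Y h (suspension_flow f X (p, t)) =
      suspension_flow g Y (torus_map f X g Y h p, t)"
    by (rule source.torus_cases)
      (simp add: source.suspension_flow_proj target.suspension_flow_proj torus_map_proj)
qed

lemma torus_map_preimage_section:
  "source.section_0 = {p \<in> topspace source.torus. torus_map f X g Y h p \<in> target.section_0}"
proof -
  have "p \<in> source.section_0 \<longleftrightarrow> torus_map f X g Y h p \<in> target.section_0"
    if "p \<in> topspace source.torus" for p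
    using that by (rule source.torus_cases)
      (simp add: torus_map_proj source.proj_in_section_0_iff target.proj_in_section_0_iff)
  then show ?thesis using source.section_0_subset by blast
qed

end

lemma torus_map_ident:
  assumes "self_homeomorphism f X"
  shows "torus_map f X f X (\<lambda>x\<in>topspace X. x) = (\<lambda>p\<in>topspace (mapping_torus f X). p)"
proof -
  interpret self_homeomorphism f X by fact
  interpret id: equivariant_map f X f X "\<lambda>x\<in>topspace X. x"
    using maps continuous_map_restrict_id by unfold_locales auto
  show ?thesis
  proof (rule extensionalityI[of _ "topspace torus"])
    fix p assume p: "p \<in> topspace torus"
    then show "torus_map f X f X (\<lambda>x\<in>topspace X. x) p = (\<lambda>p\<in>topspace (mapping_torus f X). p) p"
      by (rule torus_cases) (use p in \<open>simp add: id.torus_map_proj\<close>)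
  qed (auto simp: torus_map_def)
qed

lemma equivariant_map_compose:
  assumes "equivariant_map f X g Y h" "equivariant_map g Y e Z k"
  shows "equivariant_map f X e Z (compose (topspace X) k h)"
proof -
  interpret h: equivariant_map f X g Y h by fact
  interpret k: equivariant_map g Y e Z k by fact
  show ?thesis
  proof
    show "continuous_map X Z (compose (topspace X) k h)"
      using h.cont k.cont by (rule continuous_map_compose_restrict)
    show "compose (topspace X) k h (f x) = e (compose (topspace X) k h x)" if "x \<in> topspace X" for x
      using that h.source.maps h.equivariant k.equivariant by (auto simp: compose_def)
  qed
qed

lemma torus_map_compose:
  assumes "equivariant_map f X g Y h" "equivariant_map g Y e Z k"
  shows "torus_map f X e Z (compose (topspace X) k h) =
    compose (topspace (mapping_torus f X)) (torus_map g Y e Z k) (torus_map f X g Y h)"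
proof -
  interpret h: equivariant_map f X g Y h by fact
  interpret k: equivariant_map g Y e Z k by fact
  interpret kh: equivariant_map f X e Z "compose (topspace X) k h"
    using assms by (rule equivariant_map_compose)
  show ?thesis
  proof (rule extensionalityI[of _ "topspace h.source.torus"])
    fix p assume p: "p \<in> topspace h.source.torus"
    then show "torus_map f X e Z (compose (topspace X) k h) p =
        compose (topspace (mapping_torus f X)) (torus_map g Y e Z k) (torus_map f X g Y h) p"
      by (rule h.source.torus_cases)
        (use p in \<open>simp add: compose_eq h.torus_map_proj k.torus_map_proj kh.torus_map_proj\<close>)
  qed (auto simp: torus_map_def compose_def)
qed


section \<open>Categories and the suspension functor\<close>

lemma Obj_Map_cat_iff:
  "(f, X) \<in> Obj Map_cat \<longleftrightarrow> manifold X \<and> self_homeomorphism f X \<and> f \<in> extensional (topspace X)"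
  by (simp add: Map_cat_def self_homeomorphism_def)

lemma Hom_Map_cat_iff:
  assumes "(f, X) \<in> Obj Map_cat" "(g, Y) \<in> Obj Map_cat"
  shows "h \<in> Hom Map_cat (f, X) (g, Y) \<longleftrightarrow> equivariant_map f X g Y h \<and> h \<in> extensional (topspace X)"
  using assms
  by (auto simp: Map_cat_def self_homeomorphism_def equivariant_map_def equivariant_map_axioms_def)

lemma category_Map_cat: "category Map_cat"
proof (unfold_locales, goal_cases)
  case (1 A)
  obtain f X where [simp]: "A = (f, X)" by (cases A)
  have "f x \<in> topspace X" if "x \<in> topspace X" for x
    using 1 that self_homeomorphism.maps[of f X] by (auto simp: Obj_Map_cat_iff)
  then show ?case by (simp add: Map_cat_def continuous_map_restrict_id)
next
  case (2 A B D h k)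
  obtain f X g Y e Z where [simp]: "A = (f, X)" "B = (g, Y)" "D = (e, Z)" by (cases A, cases B, cases D) auto
  have "equivariant_map f X e Z (compose (topspace X) k h)"
    using 2 by (auto simp: Hom_Map_cat_iff intro: equivariant_map_compose)
  then have "compose (topspace X) k h \<in> Hom Map_cat (f, X) (e, Z)"
    using 2 by (simp add: Hom_Map_cat_iff compose_extensional)
  then show ?case by (simp add: Map_cat_def)
next
  case (3 A B h)
  then show ?case by (auto simp: Map_cat_def intro!: Id_compose continuous_map_funspace)
next
  case (4 A B h)
  then show ?case by (auto simp: Map_cat_def intro!: compose_Id continuous_map_funspace)
next
  case (5 A B D E h k l)
  then show ?case by (auto simp: Map_cat_def intro!: compose_assoc continuous_map_funspace)
qed

text \<open>
  Compositions and identities are restricted to the underlying space, so each law needs that flows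
  and morphisms do not leave these spaces.
\<close>

lemma category_FlowGS_cat: "category FlowGS_cat"
proof (unfold_locales, goal_cases)
  case (1 A)
  obtain \<Phi> X S where [simp]: "A = (\<Phi>, X, S)" by (cases A) auto
  have "flow \<Phi> X" "S \<subseteq> topspace X"
    using 1 by (auto simp: FlowGS_cat_def global_poincare_section_def topologically_transversal_def)
  moreover have "\<Phi> (x, t) \<in> topspace X" if "x \<in> topspace X" for x t
    using continuous_map_funspace[of "prod_topology X euclideanreal" X \<Phi>] that \<open>flow \<Phi> X\<close>
    by (auto simp: flow_def)
  ultimately show ?case by (auto simp: FlowGS_cat_def flow_morphism_def continuous_map_restrict_id)
next
  case (2 A B D h k)
  obtain \<Phi> X S \<Psi> Y S' \<Theta> Z S'' where [simp]: "A = (\<Phi>, X, S)" "B = (\<Psi>, Y, S')" "D = (\<Theta>, Z, S'')"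
    by (cases A, cases B, cases D) auto
  have "\<Phi> (x, t) \<in> topspace X" if "x \<in> topspace X" for x t
    using continuous_map_funspace[of "prod_topology X euclideanreal" X \<Phi>] that 2
    by (auto simp: FlowGS_cat_def flow_def)
  moreover have "h x \<in> topspace Y" if "x \<in> topspace X" for x
    using 2 that continuous_map_funspace[of X Y h] by (auto simp: FlowGS_cat_def flow_morphism_def)
  ultimately show ?case
    using 2
    by (auto simp: FlowGS_cat_def flow_morphism_def compose_extensional compose_eq
        intro: continuous_map_compose_restrict)
next
  case (3 A B h)
  then show ?case
    by (auto simp: FlowGS_cat_def flow_morphism_def intro!: Id_compose continuous_map_funspace)
next
  case (4 A B h)
  then show ?case
    by (auto simp: FlowGS_cat_def flow_morphism_def intro!: compose_Id continuous_map_funspace)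
next
  case (5 A B D E h k l)
  then show ?case
    by (auto simp: FlowGS_cat_def flow_morphism_def intro!: compose_assoc continuous_map_funspace)
qed

definition suspension_functor ::
  "('a map_obj, 'a \<Rightarrow> 'a, ('a \<times> real) set flowgs_obj, ('a \<times> real) set \<Rightarrow> ('a \<times> real) set) prefunctor"
  where "suspension_functor = \<lparr>
    obj_map = (\<lambda>(f, X). (suspension_flow f X, mapping_torus f X, torus_zero_section f X)),
    mor_map = (\<lambda>(f, X) (g, Y) h. torus_map f X g Y h)\<rparr>"

lemma cat_functor_suspension: "cat_functor Map_cat FlowGS_cat suspension_functor"
proof -
  interpret source: category Map_cat by (rule category_Map_cat)
  interpret target: category FlowGS_cat by (rule category_FlowGS_cat)
  show ?thesis
  proof (unfold_locales, goal_cases)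
    case (1 A)
    obtain f X where [simp]: "A = (f, X)" by (cases A)
    interpret self_homeomorphism f X using 1 by (simp add: Obj_Map_cat_iff)
    have "manifold X" using 1 by (simp add: Obj_Map_cat_iff)
    then show ?case
      by (simp add: suspension_functor_def FlowGS_cat_def flow_suspension_flow
          global_poincare_section_section_0)
  next
    case (2 A B h)
    obtain f X g Y where [simp]: "A = (f, X)" "B = (g, Y)" by (cases A, cases B) auto
    interpret equivariant_map f X g Y h using 2 Hom_Map_cat_iff[of f X g Y h] by simp
    show ?case
      using flow_morphism_torus_map torus_map_preimage_section
      by (simp add: suspension_functor_def FlowGS_cat_def)
  next
    case (3 A)
    obtain f X where [simp]: "A = (f, X)" by (cases A)
    have "self_homeomorphism f X" using 3 by (simp add: Obj_Map_cat_iff)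
    from torus_map_ident[OF this] show ?case
      by (simp add: suspension_functor_def FlowGS_cat_def Map_cat_def)
  next
    case (4 A B E h k)
    obtain f X g Y e Z where [simp]: "A = (f, X)" "B = (g, Y)" "E = (e, Z)"
      by (cases A, cases B, cases E) auto
    have "equivariant_map f X g Y h" "equivariant_map g Y e Z k" 
      using 4 Hom_Map_cat_iff[of f X g Y h] Hom_Map_cat_iff[of g Y e Z k] by simp_all
    from torus_map_compose[OF this] show ?case
      by (simp add: suspension_functor_def FlowGS_cat_def Map_cat_def)
  qed
qed

theorem theorem4p3:
  shows "\<exists>\<Sigma> :: ('a map_obj, 'a \<Rightarrow> 'a, ('a \<times> real) set flowgs_obj,
                 ('a \<times> real) set \<Rightarrow> ('a \<times> real) set) prefunctor.
    cat_functor Map_cat FlowGS_cat \<Sigma> \<and>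
    (\<forall>f X. (f, X) \<in> Obj Map_cat \<longrightarrow>
      obj_map \<Sigma> (f, X) = (suspension_flow f X, mapping_torus f X, torus_zero_section f X)) \<and>
    (\<forall>f X g Y h. (f, X) \<in> Obj Map_cat \<and> (g, Y) \<in> Obj Map_cat \<and> h \<in> Hom Map_cat (f, X) (g, Y) \<longrightarrow>
      (\<forall>x\<in>topspace X. \<forall>t. 0 \<le> t \<and> t < 1 \<longrightarrow>
        mor_map \<Sigma> (f, X) (g, Y) h (torus_point f X x t) = torus_point g Y (h x) t))"
proof (intro exI[of _ suspension_functor] conjI cat_functor_suspension allI impI ballI; (elim conjE)?)
  fix f :: "'a \<Rightarrow> 'a" and X g Y h x and t :: real
  assume "(f, X) \<in> Obj Map_cat" "(g, Y) \<in> Obj Map_cat" "h \<in> Hom Map_cat (f, X) (g, Y)"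
    and xt: "x \<in> topspace X" "0 \<le> t" "t < 1"
  then interpret equivariant_map f X g Y h using Hom_Map_cat_iff by blast
  show "mor_map suspension_functor (f, X) (g, Y) h (torus_point f X x t) = torus_point g Y (h x) t"
    using torus_map_point[OF xt] by (simp add: suspension_functor_def)
qed (simp add: suspension_functor_def)

end
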